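(* Let $P(\partial_t,D_x)=\partial_t^m+\sum_{k=1}^m a_k(D_x)\partial_t^{m-k}$, where $m\ge1$ and $a_k(\xi)$, $1\le k\le m$, are polynomials on $\mathbb{R}^d$ of arbitrary degree. Assume that there are constants $C_0>0$, $\nu\ge1$ such that $$(\tau,\zeta)\in\mathbb{C}\times\mathbb{C}^d,\quad P(i\tau,\zeta)=0\ \Longrightarrow\ \operatorname{Im}\tau\ge -C_0(1+|\operatorname{Im}\zeta|)^\nu,$$ and set $r=\min\{2,\nu/(\nu-1)\}$ (with $\nu/(\nu-1)=+\infty$, i.e. $r=2$, if $\nu=1$). If $g\in S^{1/r}_{1/r}(\mathbb{R}^d)$, then for every $t\ge0$ the propagator $\sigma(t,D_x)$ satisfies $$|\langle\sigma(t,D_x)\pi(z)g,\pi(w)g\rangle|\le C\exp\big(-\epsilon|w-z|^r\big)\qquad\text{for all }z,w\in\mathbb{R}^{2d},$$ for some constants $\epsilon>0$ and $C>0$. The constants $\epsilon$ and $C$ are uniform when $t$ lies in bounded subsets of $[0,+\infty)$.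
   Context: Here $t\in\mathbb{R}$, $x\in\mathbb{R}^d$, $D_{x_j}=\frac{1}{2\pi i}\partial_{x_j}$, and the polynomials $a_k$ may have complex coefficients and be non-homogeneous. $P(i\tau,\zeta)=(i\tau)^m+\sum_{k=1}^m a_k(\zeta)(i\tau)^{m-k}$ for $(\tau,\zeta)\in\mathbb{C}\times\mathbb{C}^d$. The symbol $\sigma(t,\xi)$ of the propagator is, for each $\xi$, the unique solution of $$\Big(\partial_t^m+\sum_{k=1}^m a_k(\xi)\partial_t^{m-k}\Big)\sigma(t,\xi)=\delta(t)$$ supported in $[0,+\infty)\times\mathbb{R}^d$; equivalently, for $t\ge0$, $\sigma(\cdot,\xi)$ solves the homogeneous ODE with $\partial_t^k\sigma(0,\xi)=0$ for $0\le k\le m-2$ and $\partial_t^{m-1}\sigma(0,\xi)=1$ (values at $t=0$ taken from the right). The propagator is the Fourier multiplier $\sigma(t,D_x)f=\mathcal{F}^{-1}(\sigma(t,\cdot)\mathcal{F}f)$, with $\mathcal{F}f(\xi)=\int f(x)e^{-2\pi ix\cdot\xi}\,dx$. For $z=(x,\xi)\in\mathbb{R}^{2d}$, $\pi(z)f(y)=e^{2\pi i\xi\cdot y}f(y-x)$; $\langle f,g\rangle=\int f\overline g$. For $s>0$, $S^s_s(\mathbb{R}^d)$ is the Gelfand-Shilov space of $f\in\mathcal{S}(\mathbb{R}^d)$ such that for some $A,B,c>0$, $|x^\alpha\partial^\beta f(x)|\le cA^{|\alpha|}B^{|\beta|}(\alpha!)^s(\beta!)^s$ for all $x\in\mathbb{R}^d$,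 $\alpha,\beta\in\mathbb{N}^d$. *)

theory Defs
  imports "HOL-Analysis.Analysis" "HOL-Library.Poly_Mapping"
begin

type_synonym 'd mpoly = "('d \<Rightarrow>\<^sub>0 nat) \<Rightarrow>\<^sub>0 complex"

definition mpoly_eval :: "('d::finite) mpoly \<Rightarrow> complex^'d \<Rightarrow> complex" where
  "mpoly_eval p \<zeta> =
     (\<Sum>\<alpha>\<in>Poly_Mapping.keys p. Poly_Mapping.lookup p \<alpha> * (\<Prod>j\<in>UNIV. (\<zeta> $ j) ^ Poly_Mapping.lookup \<alpha> j))"

definition cvec :: "real^'d \<Rightarrow> complex^'d" where
  "cvec \<xi> = (\<chi> j. complex_of_real (\<xi> $ j))"

definition Im_vec :: "complex^'d \<Rightarrow> real^'d" where
  "Im_vec \<zeta> = (\<chi> j. Im (\<zeta> $ j))"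

text \<open>\<open>full_symbol m a s \<zeta>\<close> is \<open>P(s, \<zeta>)\<close>, the full (not the principal) symbol of the operator.\<close>

definition full_symbol ::
    "nat \<Rightarrow> (nat \<Rightarrow> ('d::finite) mpoly) \<Rightarrow> complex \<Rightarrow> complex^'d \<Rightarrow> complex" where
  "full_symbol m a s \<zeta> = s ^ m + (\<Sum>k=1..m. mpoly_eval (a k) \<zeta> * s ^ (m - k))"

text \<open>The solution supported in \<open>[0, \<infinity>)\<close> of
  \<open>(\<partial>\<^sup>m + c\<^sub>1 \<partial>\<^sup>m\<^sup>-\<^sup>1 + \<dots> + c\<^sub>m) f = \<delta>\<close>, for \<open>m \<ge> 1\<close>.
  Here \<open>F k\<close> is the \<open>k\<close>-th derivative of \<open>f\<close> on \<open>[0, \<infinity>)\<close>, one-sided at \<open>0\<close>; the value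
  at \<open>t = 0\<close> is the limit from the right, which for \<open>m = 1\<close> differs from that from the left.\<close>

definition is_fundamental_solution ::
    "nat \<Rightarrow> (nat \<Rightarrow> complex) \<Rightarrow> (real \<Rightarrow> complex) \<Rightarrow> bool" where
  "is_fundamental_solution m c f \<longleftrightarrow>
     (\<forall>t<0. f t = 0) \<and>
     (\<exists>F :: nat \<Rightarrow> real \<Rightarrow> complex.
        (\<forall>t\<ge>0. F 0 t = f t) \<and>
        (\<forall>k<m. \<forall>t\<ge>0. (F k has_vector_derivative F (Suc k) t) (at t within {0..})) \<and>
        (\<forall>t\<ge>0. F m t + (\<Sum>k=1..m. c k * F (m - k) t) = 0) \<and>
        (\<forall>k<m - 1. F k 0 = 0) \<and> F (m - 1) 0 = 1)"

definition propagator_symbol ::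
    "nat \<Rightarrow> (nat \<Rightarrow> ('d::finite) mpoly) \<Rightarrow> real \<Rightarrow> real^'d \<Rightarrow> complex" where
  "propagator_symbol m a t \<xi> =
     (THE f. is_fundamental_solution m (\<lambda>k. mpoly_eval (a k) (cvec \<xi>)) f) t"

definition fourier :: "(real^'d \<Rightarrow> complex) \<Rightarrow> real^'d \<Rightarrow> complex" where
  "fourier f \<xi> = (LINT x|lborel. f x * cis (- 2 * pi * (x \<bullet> \<xi>)))"

definition inv_fourier :: "(real^'d \<Rightarrow> complex) \<Rightarrow> real^'d \<Rightarrow> complex" where
  "inv_fourier h x = (LINT \<xi>|lborel. h \<xi> * cis (2 * pi * (x \<bullet> \<xi>)))"

definition fourier_multiplier ::
    "(real^'d \<Rightarrow> complex) \<Rightarrow> (real^'d \<Rightarrow> complex) \<Rightarrow> real^'d \<Rightarrow> complex" where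
  "fourier_multiplier \<mu> f = inv_fourier (\<lambda>\<xi>. \<mu> \<xi> * fourier f \<xi>)"

definition propagator ::
    "nat \<Rightarrow> (nat \<Rightarrow> ('d::finite) mpoly) \<Rightarrow> real \<Rightarrow> (real^'d \<Rightarrow> complex) \<Rightarrow> real^'d \<Rightarrow> complex" where
  "propagator m a t = fourier_multiplier (propagator_symbol m a t)"

definition tf_shift ::
    "(real^'d) \<times> (real^'d) \<Rightarrow> (real^'d \<Rightarrow> complex) \<Rightarrow> real^'d \<Rightarrow> complex" where
  "tf_shift z f y = cis (2 * pi * (snd z \<bullet> y)) * f (y - fst z)"

definition L2_inner :: "(real^'d \<Rightarrow> complex) \<Rightarrow> (real^'d \<Rightarrow> complex) \<Rightarrow> complex" where
  "L2_inner f g = (LINT y|lborel. f y * cnj (g y))"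

definition multi_monom :: "real^'d \<Rightarrow> ('d::finite \<Rightarrow> nat) \<Rightarrow> real" where
  "multi_monom x \<alpha> = (\<Prod>j\<in>UNIV. (x $ j) ^ \<alpha> j)"

definition multi_fact :: "('d::finite \<Rightarrow> nat) \<Rightarrow> real" where
  "multi_fact \<alpha> = (\<Prod>j\<in>UNIV. fact (\<alpha> j))"

text \<open>A family \<open>D\<close> as below exists iff \<open>f\<close> is \<open>C\<^sup>\<infinity>\<close>, and it is then unique, with
  \<open>D \<beta> = \<partial>\<^sup>\<beta> f\<close> for every multi-index \<open>\<beta>\<close>.\<close>

definition has_partials ::
    "(real^'d \<Rightarrow> complex) \<Rightarrow> (('d::finite \<Rightarrow> nat) \<Rightarrow> real^'d \<Rightarrow> complex) \<Rightarrow> bool" where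
  "has_partials f D \<longleftrightarrow>
     D (\<lambda>_. 0) = f \<and>
     (\<forall>\<beta> x. (D \<beta> has_derivative
        (\<lambda>h. \<Sum>j\<in>UNIV. (h $ j) *\<^sub>R D (\<beta>(j := Suc (\<beta> j))) x)) (at x))"

definition schwartz :: "(real^'d::finite \<Rightarrow> complex) set" where
  "schwartz = {f. \<exists>D. has_partials f D \<and>
     (\<forall>\<alpha> \<beta>. bounded (range (\<lambda>x. multi_monom x \<alpha> *\<^sub>R D \<beta> x)))}"

definition gelfand_shilov :: "real \<Rightarrow> (real^'d::finite \<Rightarrow> complex) set" where
  "gelfand_shilov s = {f \<in> schwartz. \<exists>D. has_partials f D \<and>
     (\<exists>A>0. \<exists>B>0. \<exists>c>0. \<forall>x \<alpha> \<beta>.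
        norm (multi_monom x \<alpha> *\<^sub>R D \<beta> x) \<le>
          c * A ^ (\<Sum>j\<in>UNIV. \<alpha> j) * B ^ (\<Sum>j\<in>UNIV. \<beta> j)
            * multi_fact \<alpha> powr s * multi_fact \<beta> powr s)}"

text \<open>\<open>\<nu> / (\<nu> - 1)\<close> is read as \<open>\<infinity>\<close> for \<open>\<nu> = 1\<close>, whereas division by zero yields \<open>0\<close> in HOL.\<close>

definition decay_exponent :: "real \<Rightarrow> real" where
  "decay_exponent \<nu> = (if \<nu> = 1 then 2 else min 2 (\<nu> / (\<nu> - 1)))"

end

theory Submission
  imports Defs "HOL-Complex_Analysis.Conformal_Mappings"
    "HOL-Computational_Algebra.Fundamental_Theorem_Algebra"
begin

text \<open>
  Factoring \<open>P(s, \<zeta>)\<close> in \<open>s\<close>, the symbol \<open>\<sigma>(t, \<zeta>)\<close> is an iterated convolution of exponentials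
  \<open>exp (t s\<^sub>i)\<close>, so the hypothesis on the roots gives
  \<open>|\<sigma>(t, \<zeta>)| \<le> t\<^sup>m\<^sup>-\<^sup>1 exp (C\<^sub>0 t (1 + |Im \<zeta>|)\<^sup>\<nu>)\<close> without any loss in \<open>|Re \<zeta>|\<close>. Likewise, integrating by
  parts in the Fourier-Laplace integral, the transform of \<open>g\<close> is entire and bounded by
  \<open>C exp (b |Im \<zeta>|\<^sup>q - c |Re \<zeta>|\<^sup>r)\<close>, where \<open>q = r / (r - 1) \<ge> \<nu>\<close> is conjugate to \<open>r\<close>. By Fubini the pairing is
  the integral over \<open>\<xi>\<close> of \<open>\<sigma>(t, \<xi>) exp (2\<pi>i y\<cdot>\<xi>)\<close> times two translates of the transform of \<open>g\<close>, with
  \<open>z = (x, \<eta>)\<close>, \<open>w = (x', \<eta>')\<close> and \<open>y = x' - x\<close>. The translates yield decay in \<open>|\<eta>' - \<eta>|\<^sup>r\<close>. Decay in \<open>|y|\<^sup>r\<close> comes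
  from moving \<open>\<xi>\<close> into the complex domain by \<open>i \<delta> |y\<^sub>j|\<^sup>r\<^sup>-\<^sup>1\<close>, up to sign, in the single coordinate \<open>j\<close> that maximises
  \<open>|y\<^sub>j|\<close>. The shift is justified without contours: the integral over \<open>\<xi> + s e\<^sub>j\<close> is an entire function of
  \<open>s\<close> which is constant on the real axis.
\<close>

section \<open>Linear ordinary differential equations and the symbol\<close>

text \<open>The integrating factor \<open>exp (- s t)\<close> removes the term
  \<open>s * f t\<close>, and the mean value inequality bounds the increment of the product
  \<open>h\<close>. A source of exponential rate \<open>M\<close> costs only a factor
  \<open>t\<close>, the origin of the powers of \<open>T\<close> under iteration.\<close>

lemma first_order_ode_bound:
  fixes f g :: "real \<Rightarrow> complex" and s :: complex
  assumes der: "\<And>t. t \<in> {0..T} \<Longrightarrow> (f has_vector_derivative s * f t + g t) (at t within {0..T})"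
    and bound: "\<And>t. t \<in> {0..T} \<Longrightarrow> norm (g t) \<le> A * exp (M * t)"
    and s: "Re s \<le> M" and t: "t \<in> {0..T}"
  shows "norm (f t) \<le> (norm (f 0) + t * A) * exp (M * t)"
proof -
  define h where "h u = exp (- s * of_real u) * f u" for u :: real
  have A0: "0 \<le> A"
    using bound[of 0] t by (auto intro: order_trans[OF norm_ge_zero])
  have dh: "(h has_vector_derivative exp (- s * of_real u) * g u) (at u within {0..t})" if "u \<in> {0..t}" for u
  proof -
    have f: "(f has_vector_derivative s * f u + g u) (at u within {0..t})"
      using der[of u] that t by (auto intro: has_vector_derivative_within_subset)
    have e: "((\<lambda>u. exp (- s * of_real u)) has_vector_derivative - s * exp (- s * of_real u)) (at u within {0..t})"
      by (rule has_vector_derivative_real_field) (auto intro!: derivative_eq_intros)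
    show ?thesis
      unfolding h_def using has_vector_derivative_mult[OF e f] by (simp add: algebra_simps)
  qed
  \<comment> \<open>As \<open>Re s \<le> M\<close>, the bound
    \<open>A * exp ((M - Re s) * u)\<close> increases with \<open>u\<close>, so its value at
    \<open>t\<close> serves on all of \<open>{0..t}\<close>.\<close>
  have "norm (h t - h 0) \<le> A * exp ((M - Re s) * t) * norm (t - 0)"
  proof (rule differentiable_bound[of "{0..t}" h "\<lambda>u d. d *\<^sub>R (exp (- s * of_real u) * g u)"])
    show "(h has_derivative (\<lambda>d. d *\<^sub>R (exp (- s * of_real u) * g u))) (at u within {0..t})" if "u \<in> {0..t}" for u
      using dh[OF that] by (simp add: has_vector_derivative_def)
    show "onorm (\<lambda>d. d *\<^sub>R (exp (- s * of_real u) * g u)) \<le> A * exp ((M - Re s) * t)" if u: "u \<in> {0..t}" for u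
    proof (rule onorm_le)
      fix d :: real
      have "norm (g u) \<le> A * exp (M * u)"
        using bound[of u] u t by auto
      hence "norm (exp (- s * of_real u) * g u) \<le> exp (- (Re s * u)) * (A * exp (M * u))"
        by (simp add: norm_mult mult_left_mono)
      also have "\<dots> = A * exp ((M - Re s) * u)"
        by (simp add: algebra_simps exp_diff exp_minus divide_simps)
      also have "\<dots> \<le> A * exp ((M - Re s) * t)"
        using A0 s u by (intro mult_left_mono) (auto intro: mult_left_mono)
      finally show "norm (d *\<^sub>R (exp (- s * of_real u) * g u)) \<le> A * exp ((M - Re s) * t) * norm d"
        by (metis abs_ge_zero mult.commute mult_left_mono norm_scaleR real_norm_def)
    qed
  qed (use t in auto)
  hence "norm (h t) \<le> norm (h 0) + A * exp ((M - Re s) * t) * t"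
    using norm_triangle_sub[of "h t" "h 0"] t by auto
  hence "norm (f t) \<le> exp (Re s * t) * (norm (f 0) + A * exp ((M - Re s) * t) * t)"
    by (simp add: h_def norm_mult norm_divide exp_minus field_simps)
  also have "\<dots> = norm (f 0) * exp (Re s * t) + t * A * exp (M * t)"
    by (simp add: algebra_simps flip: exp_add)
  also have "\<dots> \<le> norm (f 0) * exp (M * t) + t * A * exp (M * t)"
    using s t by (auto intro!: mult_left_mono mult_right_mono)
  finally show ?thesis by (simp add: algebra_simps)
qed

text \<open>Induction on the degree: splitting off a root \<open>s\<close> of \<open>p\<close>, the function
  \<open>G = (d/dt - s) F\<close> solves the equation for \<open>p / (X - s)\<close>.\<close>

lemma monic_ode_bound:
  fixes p :: "complex poly" and F :: "nat \<Rightarrow> real \<Rightarrow> complex"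
  assumes "lead_coeff p = 1" "degree p = Suc n" "\<And>s. poly p s = 0 \<Longrightarrow> Re s \<le> M"
    and "\<And>k t. k \<le> n \<Longrightarrow> t \<in> {0..T} \<Longrightarrow> (F k has_vector_derivative F (Suc k) t) (at t within {0..T})"
    and "\<And>t. t \<in> {0..T} \<Longrightarrow> (\<Sum>i\<le>Suc n. coeff p i * F i t) = 0"
    and "\<And>k. k < n \<Longrightarrow> F k 0 = 0" and "norm (F n 0) \<le> K"
    and "t \<in> {0..T}"
  shows "norm (F 0 t) \<le> K * T ^ n * exp (M * t)"
  using assms
proof (induction n arbitrary: p F t)
  case 0
  have c1: "coeff p 1 = 1" using 0 by simp
  define s where "s = - coeff p 0"
  have p: "p = [:- s, 1:]"
    using degree_eq_zeroE c1 0(2) unfolding s_def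
    by (intro poly_eqI) (auto simp: coeff_pCons coeff_eq_0 split: nat.splits)
  have s: "Re s \<le> M" by (rule 0(3)) (simp add: p)
  have "F 1 u = s * F 0 u + 0" if "u \<in> {0..T}" for u
    using 0(5)[OF that] c1 by (simp add: s_def algebra_simps add_eq_0_iff2)
  hence "(F 0 has_vector_derivative s * F 0 u + 0) (at u within {0..T})" if "u \<in> {0..T}" for u
    using 0(4)[of 0 u] that by simp
  from first_order_ode_bound[OF this _ s 0(8), of 0]
  have "norm (F 0 t) \<le> norm (F 0 0) * exp (M * t)" by simp
  also have "\<dots> \<le> K * exp (M * t)" using 0(7) by simp
  finally show ?case by simp
next
  case (Suc n)
  have "\<not> constant (poly p)"
    using Suc.prems(2) by (simp add: constant_degree)
  then obtain s where s0: "poly p s = 0"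
    using fundamental_theorem_of_algebra by blast
  then obtain q where pq: "p = [:- s, 1:] * q"
    by (auto simp: poly_eq_0_iff_dvd)
  have q0: "q \<noteq> 0" using Suc.prems(2) pq by auto
  have dq: "degree q = Suc n"
    using Suc.prems(2) q0 by (simp add: pq degree_mult_eq del: mult_pCons_left)
  have lq: "lead_coeff q = 1"
    using Suc.prems(1) by (simp add: pq lead_coeff_mult del: mult_pCons_left)
  have rq: "Re z \<le> M" if "poly q z = 0" for z
    using Suc.prems(3)[of z] that by (simp add: pq)
  have s: "Re s \<le> M" using Suc.prems(3) s0 by simp
  define G where "G k u = F (Suc k) u - s * F k u" for k u
  \<comment> \<open>Coefficientwise form of \<open>p(d/dt) F = q(d/dt) (d/dt - s) F\<close>: the
    coefficient of \<open>p\<close> at \<open>i\<close> is that of \<open>q\<close> at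
    \<open>i - 1\<close> minus \<open>s\<close> times that of \<open>q\<close> at
    \<open>i\<close>.\<close>
  have G: "(\<Sum>i\<le>Suc n. coeff q i * G i u) = (\<Sum>i\<le>Suc (Suc n). coeff p i * F i u)" for u
  proof -
    have "(\<Sum>i\<le>Suc (Suc n). coeff p i * F i u) =
        (\<Sum>i\<le>Suc (Suc n). (case i of 0 \<Rightarrow> 0 | Suc j \<Rightarrow> coeff q j) * F i u) - s * (\<Sum>i\<le>Suc (Suc n). coeff q i * F i u)"
      unfolding sum_distrib_left sum_subtractf[symmetric]
      by (intro sum.cong) (auto simp: pq coeff_pCons algebra_simps split: nat.splits)
    also have "(\<Sum>i\<le>Suc (Suc n). (case i of 0 \<Rightarrow> 0 | Suc j \<Rightarrow> coeff q j) * F i u) = (\<Sum>i\<le>Suc n. coeff q i * F (Suc i) u)"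
      by (subst sum.atMost_Suc_shift) simp
    also have "(\<Sum>i\<le>Suc (Suc n). coeff q i * F i u) = (\<Sum>i\<le>Suc n. coeff q i * F i u)"
      using dq by (simp add: coeff_eq_0)
    also have "(\<Sum>i\<le>Suc n. coeff q i * F (Suc i) u) - s * (\<Sum>i\<le>Suc n. coeff q i * F i u) = (\<Sum>i\<le>Suc n. coeff q i * G i u)"
      unfolding sum_distrib_left sum_subtractf[symmetric] G_def
      by (intro sum.cong) (auto simp: algebra_simps)
    finally show ?thesis by simp
  qed
  have IH: "norm (G 0 u) \<le> K * T ^ n * exp (M * u)" if "u \<in> {0..T}" for u
  proof (rule Suc.IH[OF lq dq rq])
    show "(G k has_vector_derivative G (Suc k) v) (at v within {0..T})" if "k \<le> n" "v \<in> {0..T}" for k v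
      unfolding G_def by (intro derivative_intros Suc.prems(4)) (use that in auto)
    show "(\<Sum>i\<le>Suc n. coeff q i * G i v) = 0" if "v \<in> {0..T}" for v
      using Suc.prems(5)[OF that] by (simp only: G)
    \<comment> \<open>Since \<open>F n 0 = 0\<close>, the last initial value of \<open>G\<close> is
      \<open>F (Suc n) 0\<close>, so the constant \<open>K\<close> passes to \<open>q\<close>
      unchanged.\<close>
    show "norm (G n 0) \<le> K" using Suc.prems(6)[of n] Suc.prems(7) by (simp add: G_def)
  qed (use that Suc.prems(6) in \<open>auto simp: G_def\<close>)
  have "norm (F 0 t) \<le> (norm (F 0 0) + t * (K * T ^ n)) * exp (M * t)"
  proof (rule first_order_ode_bound[where T = T and s = s and g = "G 0"])
    show "(F 0 has_vector_derivative s * F 0 u + G 0 u) (at u within {0..T})" if "u \<in> {0..T}" for u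
      using Suc.prems(4)[of 0 u] that by (simp add: G_def)
  qed (use IH s Suc.prems(8) in auto)
  also have "F 0 0 = 0" using Suc.prems(6) by simp
  also have "(norm (0::complex) + t * (K * T ^ n)) * exp (M * t) \<le> K * T ^ Suc n * exp (M * t)"
  proof -
    have "0 \<le> K" "t \<le> T" "0 \<le> T"
      using Suc.prems(8) order_trans[OF norm_ge_zero Suc.prems(7)] by auto
    hence "t * (K * T ^ n) \<le> T * (K * T ^ n)"
      by (intro mult_right_mono) auto
    thus ?thesis by (intro mult_right_mono) (auto simp: algebra_simps)
  qed
  finally show ?case .
qed

section \<open>Growth and uniqueness of the fundamental solution\<close>

definition char_poly :: "nat \<Rightarrow> (nat \<Rightarrow> complex) \<Rightarrow> complex poly" where
  "char_poly m c = (\<Sum>i\<le>m. monom (if i = m then 1 else c (m - i)) i)"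

lemma coeff_char_poly:
  "coeff (char_poly m c) i = (if i < m then c (m - i) else if i = m then 1 else 0)"
  by (auto simp: char_poly_def coeff_sum)

lemma degree_char_poly [simp]: "degree (char_poly m c) = m"
  by (rule antisym) (auto intro!: degree_le le_degree simp: coeff_char_poly)

lemma lead_coeff_char_poly: "lead_coeff (char_poly m c) = 1"
  by (simp add: coeff_char_poly)

lemma sum_coeff_char_poly:
  "(\<Sum>i\<le>m. coeff (char_poly m c) i * f i) = f m + (\<Sum>k=1..m. c k * f (m - k))"
proof -
  have "(\<Sum>i\<le>m. coeff (char_poly m c) i * f i) = f m + (\<Sum>i<m. c (m - i) * f i)"
    by (simp add: coeff_char_poly flip: lessThan_Suc_atMost)
  also have "(\<Sum>i<m. c (m - i) * f i) = (\<Sum>k=1..m. c k * f (m - k))"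
    by (rule sum.reindex_bij_witness[of _ "\<lambda>k. m - k" "\<lambda>i. m - i"]) auto
  finally show ?thesis .
qed

lemma poly_char_poly: "poly (char_poly m c) s = s ^ m + (\<Sum>k=1..m. c k * s ^ (m - k))"
  using sum_coeff_char_poly[of m c "\<lambda>i. s ^ i"] by (simp add: poly_altdef)

text \<open>The initial values \<open>0, ..., 0, 1\<close> allow \<open>K = 1\<close> in
  \<open>monic_ode_bound\<close>. The coefficients \<open>c\<close> enter only through the real
  parts of the roots, so there is no loss when they grow with the frequency.\<close>

lemma fundamental_solution_bound:
  assumes m: "m \<ge> 1" and f: "is_fundamental_solution m c f"
    and roots: "\<And>s. s ^ m + (\<Sum>k=1..m. c k * s ^ (m - k)) = 0 \<Longrightarrow> Re s \<le> M"
    and t: "t \<in> {0..T}"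
  shows "norm (f t) \<le> T ^ (m - 1) * exp (M * t)"
proof -
  obtain F where F0: "\<And>t. t \<ge> 0 \<Longrightarrow> F 0 t = f t"
    and dF: "\<And>k t. k < m \<Longrightarrow> t \<ge> 0 \<Longrightarrow> (F k has_vector_derivative F (Suc k) t) (at t within {0..})"
    and ode: "\<And>t. t \<ge> 0 \<Longrightarrow> F m t + (\<Sum>k=1..m. c k * F (m - k) t) = 0"
    and init: "\<And>k. k < m - 1 \<Longrightarrow> F k 0 = 0" "F (m - 1) 0 = 1"
    using f unfolding is_fundamental_solution_def by blast
  have "norm (F 0 t) \<le> 1 * T ^ (m - 1) * exp (M * t)"
  proof (rule monic_ode_bound[OF lead_coeff_char_poly[of m c], where n = "m - 1"])
    show "(F k has_vector_derivative F (Suc k) u) (at u within {0..T})" if "k \<le> m - 1" "u \<in> {0..T}" for k u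
      by (rule has_vector_derivative_within_subset[OF dF]) (use that m in auto)
    show "(\<Sum>i\<le>Suc (m - 1). coeff (char_poly m c) i * F i u) = 0" if "u \<in> {0..T}" for u
      using ode[of u] that m sum_coeff_char_poly[of m c "\<lambda>i. F i u"] by simp
  qed (use m t init roots in \<open>auto simp: poly_char_poly\<close>)
  thus ?thesis using F0[of t] t by simp
qed

text \<open>The difference of two solutions satisfies the same equation with vanishing initial
  values, so \<open>monic_ode_bound\<close> applies with \<open>K = 0\<close>.\<close>

lemma fundamental_solution_unique:
  assumes m: "m \<ge> 1" and f: "is_fundamental_solution m c f" and g: "is_fundamental_solution m c g"
  shows "f = g"
proof
  fix t
  show "f t = g t"
  proof (cases "t < 0")
    case True
    thus ?thesis using f g by (simp add: is_fundamental_solution_def)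
  next
    case False
    obtain F where F0: "\<And>t. t \<ge> 0 \<Longrightarrow> F 0 t = f t"
      and dF: "\<And>k t. k < m \<Longrightarrow> t \<ge> 0 \<Longrightarrow> (F k has_vector_derivative F (Suc k) t) (at t within {0..})"
      and odeF: "\<And>t. t \<ge> 0 \<Longrightarrow> F m t + (\<Sum>k=1..m. c k * F (m - k) t) = 0"
      and initF: "\<And>k. k < m - 1 \<Longrightarrow> F k 0 = 0" "F (m - 1) 0 = 1"
      using f unfolding is_fundamental_solution_def by blast
    obtain G where G0: "\<And>t. t \<ge> 0 \<Longrightarrow> G 0 t = g t"
      and dG: "\<And>k t. k < m \<Longrightarrow> t \<ge> 0 \<Longrightarrow> (G k has_vector_derivative G (Suc k) t) (at t within {0..})"
      and odeG: "\<And>t. t \<ge> 0 \<Longrightarrow> G m t + (\<Sum>k=1..m. c k * G (m - k) t) = 0"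
      and initG: "\<And>k. k < m - 1 \<Longrightarrow> G k 0 = 0" "G (m - 1) 0 = 1"
      using g unfolding is_fundamental_solution_def by blast
    have "char_poly m c \<noteq> 0" using lead_coeff_char_poly[of m c] by auto
    hence fin: "finite {s. poly (char_poly m c) s = 0}" by (rule poly_roots_finite)
    \<comment> \<open>Any upper bound for the real parts of the roots will do; the inserted
      \<open>0\<close> ensures that the maximum is taken over a nonempty set.\<close>
    define M where "M = Max (insert 0 (Re ` {s. poly (char_poly m c) s = 0}))"
    have M: "Re s \<le> M" if "poly (char_poly m c) s = 0" for s
      unfolding M_def using that fin by (intro Max_ge) auto
    have "norm (F 0 t - G 0 t) \<le> 0 * t ^ (m - 1) * exp (M * t)"
    proof (rule monic_ode_bound[OF lead_coeff_char_poly[of m c] _ M, where n = "m - 1" and F = "\<lambda>k t. F k t - G k t"])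
      show "((\<lambda>t. F k t - G k t) has_vector_derivative (F (Suc k) u - G (Suc k) u)) (at u within {0..t})"
        if "k \<le> m - 1" "u \<in> {0..t}" for k u
        by (intro has_vector_derivative_diff has_vector_derivative_within_subset[OF dF]
              has_vector_derivative_within_subset[OF dG]) (use that m in auto)
      show "(\<Sum>i\<le>Suc (m - 1). coeff (char_poly m c) i * (F i u - G i u)) = 0" if "u \<in> {0..t}" for u
        using odeF[of u] odeG[of u] that m
          sum_coeff_char_poly[of m c "\<lambda>i. F i u"] sum_coeff_char_poly[of m c "\<lambda>i. G i u"]
        by (simp add: right_diff_distrib sum_subtractf)
    qed (use m False initF initG in auto)
    thus ?thesis using F0[of t] G0[of t] False by simp
  qed
qed

text \<open>Taylor coefficients at \<open>0\<close> of the fundamental solution.\<close>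

function ode_coeff :: "nat \<Rightarrow> (nat \<Rightarrow> complex) \<Rightarrow> nat \<Rightarrow> complex" where
  "ode_coeff m c n =
     (if Suc n < m then 0 else if Suc n = m then 1 else - (\<Sum>k\<in>{1..m}. c k * ode_coeff m c (n - k)))"
  by auto
termination
  by (relation "Wellfounded.measure (\<lambda>(m, c, n). n)") auto

declare ode_coeff.simps [simp del]

text \<open>Since \<open>ode_coeff m c n\<close> is the derivative of order \<open>n\<close> at
  \<open>0\<close>, not yet divided by \<open>fact n\<close>, differentiation is a shift of the
  index, and \<open>k\<close> is the order of differentiation. Time is complex because the
  coefficients are.\<close>

definition ode_series :: "nat \<Rightarrow> (nat \<Rightarrow> complex) \<Rightarrow> nat \<Rightarrow> complex \<Rightarrow> complex" where
  "ode_series m c k t = suminf (\<lambda>n. ode_coeff m c (n + k) / fact n * t ^ n)"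

text \<open>Each use of the recursion lowers the index by at least one and costs at most a factor
  \<open>R\<close>; \<open>R \<ge> 1\<close> lets the powers of lower order be replaced by
  \<open>R ^ (n - 1)\<close>.\<close>

lemma norm_ode_coeff_le:
  assumes "R \<ge> 1" "(\<Sum>k=1..m. norm (c k)) \<le> R"
  shows "norm (ode_coeff m c n) \<le> R ^ n"
proof (induction n rule: less_induct)
  case (less n)
  consider "Suc n < m" | "Suc n = m" | "Suc n > m" by linarith
  thus ?case
  proof cases
    case 3
    have "norm (ode_coeff m c n) \<le> (\<Sum>k=1..m. norm (c k * ode_coeff m c (n - k)))"
      using 3 by (subst ode_coeff.simps) (simp add: norm_sum)
    also have "\<dots> \<le> (\<Sum>k=1..m. norm (c k) * R ^ (n - 1))"
    proof (rule sum_mono)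
      fix k assume k: "k \<in> {1..m}"
      have "norm (ode_coeff m c (n - k)) \<le> R ^ (n - k)"
        by (rule less) (use k 3 in auto)
      also have "\<dots> \<le> R ^ (n - 1)"
        using k assms by (intro power_increasing) auto
      finally show "norm (c k * ode_coeff m c (n - k)) \<le> norm (c k) * R ^ (n - 1)"
        by (simp add: norm_mult mult_left_mono)
    qed
    also have "\<dots> = (\<Sum>k=1..m. norm (c k)) * R ^ (n - 1)" by (simp add: sum_distrib_right)
    finally have 1: "norm (ode_coeff m c n) \<le> (\<Sum>k=1..m. norm (c k)) * R ^ (n - 1)" .
    show ?thesis
    \<comment> \<open>At \<open>n = 0\<close> the truncated \<open>n - 1\<close> would leave a spare
      factor \<open>R\<close>; but there \<open>m = 0\<close> and the sum is empty.\<close>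
    proof (cases n)
      case 0
      with 3 have "m = 0" by simp
      thus ?thesis by (subst ode_coeff.simps) (simp add: 0)
    next
      case (Suc j)
      have "(\<Sum>k=1..m. norm (c k)) * R ^ (n - 1) \<le> R * R ^ (n - 1)"
        using assms by (intro mult_right_mono) auto
      with 1 show ?thesis by (simp add: Suc)
    qed
  qed (use assms in \<open>subst ode_coeff.simps; simp\<close>)+
qed

text \<open>The majorant is a term of the series of \<open>R ^ k * exp (R * norm t)\<close> and
  depends on \<open>c\<close> only through \<open>R\<close>. It gives convergence and, where the
  coefficients are bounded, uniformity in parameters.\<close>

lemma norm_ode_series_term_le:
  assumes "R \<ge> 1" "(\<Sum>k=1..m. norm (c k)) \<le> R"
  shows "norm (ode_coeff m c (n + k) / fact n * t ^ n) \<le> R ^ k * ((R * norm t) ^ n /\<^sub>R fact n)"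
proof -
  have "norm (ode_coeff m c (n + k) / fact n * t ^ n) = norm (ode_coeff m c (n + k)) * (norm t ^ n / fact n)"
    by (simp add: norm_mult norm_divide norm_power)
  also have "\<dots> \<le> R ^ (n + k) * (norm t ^ n / fact n)"
    by (intro mult_right_mono norm_ode_coeff_le assms) auto
  also have "\<dots> = R ^ k * ((R * norm t) ^ n /\<^sub>R fact n)"
    by (simp add: power_add power_mult_distrib field_simps)
  finally show ?thesis .
qed

lemma summable_ode_series: "summable (\<lambda>n. ode_coeff m c (n + k) / fact n * t ^ n)"
proof (rule summable_comparison_test')
  let ?R = "1 + (\<Sum>k=1..m. norm (c k))"
  show "summable (\<lambda>n. ?R ^ k * ((?R * norm t) ^ n /\<^sub>R fact n))"
    by (intro summable_mult summable_exp_generic)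
  show "norm (ode_coeff m c (n + k) / fact n * t ^ n) \<le> ?R ^ k * ((?R * norm t) ^ n /\<^sub>R fact n)" if "n \<ge> 0" for n
    by (rule norm_ode_series_term_le) (auto simp: sum_nonneg)
qed

lemma ode_series_0: "ode_series m c k 0 = ode_coeff m c k"
  unfolding ode_series_def
  by (subst suminf_finite[of "{0}"]) (auto simp: power_0_left)

lemma ode_series_has_derivative:
  "(ode_series m c k has_field_derivative ode_series m c (Suc k) t) (at t)"
proof -
  have "diffs (\<lambda>n. ode_coeff m c (n + k) / fact n) = (\<lambda>n. ode_coeff m c (n + Suc k) / fact n)"
    by (auto simp: diffs_def divide_simps simp flip: of_nat_Suc)
  thus ?thesis
    using termdiffs_strong_converges_everywhere[OF summable_ode_series[of m c k], of t]
    by (simp add: ode_series_def[abs_def])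
qed

text \<open>At index \<open>n + m\<close> the third branch of the recursion applies, and it is the
  differential equation read off at \<open>t ^ n / fact n\<close>.\<close>

lemma ode_series_ode:
  "ode_series m c m t + (\<Sum>k=1..m. c k * ode_series m c (m - k) t) = 0"
proof -
  have "(\<Sum>k=1..m. c k * ode_series m c (m - k) t) =
      suminf (\<lambda>n. \<Sum>k=1..m. c k * (ode_coeff m c (n + (m - k)) / fact n * t ^ n))"
    unfolding ode_series_def
    by (simp only: suminf_mult[OF summable_ode_series, symmetric]
        suminf_sum[OF summable_mult[OF summable_ode_series]])
  also have "\<dots> = suminf (\<lambda>n. - (ode_coeff m c (n + m) / fact n * t ^ n))"
  proof (intro arg_cong[where f = suminf] ext)
    fix n
    have "(\<Sum>k=1..m. c k * (ode_coeff m c (n + (m - k)) / fact n * t ^ n)) =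
        (\<Sum>k=1..m. c k * ode_coeff m c (n + m - k)) * (t ^ n / fact n)"
      unfolding sum_distrib_right by (intro sum.cong) auto
    also have "(\<Sum>k=1..m. c k * ode_coeff m c (n + m - k)) = - ode_coeff m c (n + m)"
      by (subst (2) ode_coeff.simps) auto
    finally show "(\<Sum>k=1..m. c k * (ode_coeff m c (n + (m - k)) / fact n * t ^ n)) =
        - (ode_coeff m c (n + m) / fact n * t ^ n)" by simp
  qed
  also have "\<dots> = - ode_series m c m t"
    unfolding ode_series_def by (rule suminf_minus[OF summable_ode_series])
  finally show ?thesis by simp
qed

lemma is_fundamental_solution_ode_series:
  assumes "m \<ge> 1"
  shows "is_fundamental_solution m c (\<lambda>t. if t < 0 then 0 else ode_series m c 0 (of_real t))"
  unfolding is_fundamental_solution_def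
proof (intro conjI exI[of _ "\<lambda>k t. ode_series m c k (complex_of_real t)"])
  show "\<forall>k<m. \<forall>t\<ge>0. ((\<lambda>t. ode_series m c k (complex_of_real t)) has_vector_derivative
      ode_series m c (Suc k) (complex_of_real t)) (at t within {0..})"
    by (auto intro!: has_vector_derivative_real_field ode_series_has_derivative[THEN DERIV_subset])
qed (use assms in \<open>auto simp: ode_series_ode[simplified] ode_series_0 ode_coeff.simps\<close>)

text \<open>Given by the power series instead of the definite description, so that analytic
  dependence on \<open>\<zeta>\<close> follows from that of the coefficients.\<close>

definition ext_symbol :: "nat \<Rightarrow> (nat \<Rightarrow> ('d::finite) mpoly) \<Rightarrow> real \<Rightarrow> complex^'d \<Rightarrow> complex" where
  "ext_symbol m a t \<zeta> = ode_series m (\<lambda>k. mpoly_eval (a k) \<zeta>) 0 (of_real t)"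

text \<open>Existence and uniqueness together evaluate the definite description, and
  \<open>t \<ge> 0\<close> selects the branch given by the series.\<close>

lemma propagator_symbol_eq:
  assumes "m \<ge> 1" "t \<ge> 0"
  shows "propagator_symbol m a t \<xi> = ext_symbol m a t (cvec \<xi>)"
proof -
  have "(THE f. is_fundamental_solution m (\<lambda>k. mpoly_eval (a k) (cvec \<xi>)) f) =
      (\<lambda>t. if t < 0 then 0 else ode_series m (\<lambda>k. mpoly_eval (a k) (cvec \<xi>)) 0 (of_real t))"
    by (rule the_equality)
      (auto intro: is_fundamental_solution_ode_series fundamental_solution_unique assms)
  thus ?thesis using assms by (simp add: propagator_symbol_def ext_symbol_def)
qed

lemma ext_symbol_bound:
  fixes a :: "nat \<Rightarrow> ('d::finite) mpoly"
  assumes m: "m \<ge> 1"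
    and roots: "\<And>s. full_symbol m a s \<zeta> = 0 \<Longrightarrow> Re s \<le> M"
    and t: "t \<in> {0..T}"
  shows "norm (ext_symbol m a t \<zeta>) \<le> T ^ (m - 1) * exp (M * t)"
  using fundamental_solution_bound[OF m is_fundamental_solution_ode_series[OF m] _ t,
      of "\<lambda>k. mpoly_eval (a k) \<zeta>" M] roots t
  by (auto simp: full_symbol_def ext_symbol_def)

section \<open>Regularity of the symbol in the frequency\<close>

lemma continuous_on_mpoly_eval:
  "continuous_on UNIV (mpoly_eval p)"
  unfolding mpoly_eval_def[abs_def] by (intro continuous_intros)

lemma continuous_on_ode_coeff:
  assumes "\<And>k. continuous_on A (c k)"
  shows "continuous_on A (\<lambda>x. ode_coeff m (\<lambda>k. c k x) n)"
proof (induction n rule: less_induct)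
  case (less n)
  show ?case
    by (cases "Suc n < m"; cases "Suc n = m"; subst ode_coeff.simps)
      (auto intro!: continuous_intros assms less simp del: One_nat_def)
qed

lemma holomorphic_on_ode_coeff:
  assumes "\<And>k. (c k) holomorphic_on A"
  shows "(\<lambda>x. ode_coeff m (\<lambda>k. c k x) n) holomorphic_on A"
proof (induction n rule: less_induct)
  case (less n)
  show ?case
    by (cases "Suc n < m"; cases "Suc n = m"; subst ode_coeff.simps)
      (auto intro!: holomorphic_intros assms less simp del: One_nat_def)
qed

lemma borel_measurable_ode_series:
  fixes c :: "nat \<Rightarrow> 'a::topological_space \<Rightarrow> complex"
  assumes "\<And>k. continuous_on UNIV (c k)"
  shows "(\<lambda>x. ode_series m (\<lambda>k. c k x) j t) \<in> borel_measurable borel"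
  unfolding ode_series_def
  by (intro borel_measurable_suminf[OF borel_measurable_continuous_onI] continuous_intros continuous_on_ode_coeff assms) auto

text \<open>The partial sums are polynomials in the coefficients. On a closed disc the coefficients
  are bounded, so \<open>norm_ode_series_term_le\<close> supplies a uniform majorant for the
  Weierstrass test.\<close>

lemma holomorphic_ode_series:
  fixes c :: "nat \<Rightarrow> complex \<Rightarrow> complex"
  assumes c: "\<And>k. (c k) holomorphic_on UNIV"
  shows "(\<lambda>z. ode_series m (\<lambda>k. c k z) j t) holomorphic_on UNIV"
proof (rule holomorphic_uniform_sequence[OF open_UNIV])
  show "(\<lambda>z. \<Sum>n<N. ode_coeff m (\<lambda>k. c k z) (n + j) / fact n * t ^ n) holomorphic_on UNIV" for N
    by (intro holomorphic_intros holomorphic_on_ode_coeff c) auto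
  fix z :: complex
  have "continuous_on (cball z 1) (\<lambda>z. \<Sum>k=1..m. norm (c k z))"
    by (intro continuous_intros holomorphic_on_imp_continuous_on holomorphic_on_subset[OF c]) auto
  hence "bounded ((\<lambda>z. \<Sum>k=1..m. norm (c k z)) ` cball z 1)"
    by (intro compact_imp_bounded compact_continuous_image) auto
  then obtain R0 where R0: "\<And>w. w \<in> cball z 1 \<Longrightarrow> norm (\<Sum>k=1..m. norm (c k w)) \<le> R0"
    unfolding bounded_iff by blast
  define R where "R = max 1 R0"
  have "uniform_limit (cball z 1) (\<lambda>N w. \<Sum>n<N. ode_coeff m (\<lambda>k. c k w) (n + j) / fact n * t ^ n)
      (\<lambda>w. ode_series m (\<lambda>k. c k w) j t) sequentially"
    unfolding ode_series_def
  proof (rule Weierstrass_m_test)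
    show "summable (\<lambda>n. R ^ j * ((R * norm t) ^ n /\<^sub>R fact n))"
      by (intro summable_mult summable_exp_generic)
    show "norm (ode_coeff m (\<lambda>k. c k w) (n + j) / fact n * t ^ n) \<le> R ^ j * ((R * norm t) ^ n /\<^sub>R fact n)"
      if "w \<in> cball z 1" for n w
      by (rule norm_ode_series_term_le) (use R0[OF that] in \<open>auto simp: R_def\<close>)
  qed
  thus "\<exists>d>0. cball z d \<subseteq> UNIV \<and> uniform_limit (cball z d)
      (\<lambda>N w. \<Sum>n<N. ode_coeff m (\<lambda>k. c k w) (n + j) / fact n * t ^ n)
      (\<lambda>w. ode_series m (\<lambda>k. c k w) j t) sequentially"
    by (intro exI[of _ 1]) auto
qed

lemma holomorphic_mpoly_eval:
  fixes h :: "complex \<Rightarrow> complex^'d::finite"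
  assumes "\<And>i. (\<lambda>s. h s $ i) holomorphic_on A"
  shows "(\<lambda>s. mpoly_eval p (h s)) holomorphic_on A"
  unfolding mpoly_eval_def by (intro holomorphic_intros assms)

lemma holomorphic_ext_symbol:
  fixes h :: "complex \<Rightarrow> complex^'d::finite"
  assumes "\<And>i. (\<lambda>s. h s $ i) holomorphic_on UNIV"
  shows "(\<lambda>s. ext_symbol m a t (h s)) holomorphic_on UNIV"
  unfolding ext_symbol_def by (intro holomorphic_ode_series holomorphic_mpoly_eval assms)

lemma borel_measurable_ext_symbol [measurable]:
  "ext_symbol m a t \<in> borel_measurable borel"
  unfolding ext_symbol_def[abs_def]
  by (intro borel_measurable_ode_series continuous_on_mpoly_eval)

section \<open>Exponential decay\<close>

lemma integrable_exp_neg_abs: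
  assumes c: "c > 0"
  shows "integrable lborel (\<lambda>u::real. exp (- c * \<bar>u\<bar>))"
proof -
  let ?h = "\<lambda>u::real. indicator {0..} u *\<^sub>R exp (- c * u)"
  have "integrable lebesgue ?h"
    by (intro nonnegative_absolutely_integrable_1 [unfolded set_integrable_def]
        integrable_on_exp_minus_to_infinity c) auto
  hence 1: "integrable lborel ?h"
    by (simp add: integrable_completion)
  \<comment> \<open>Reflection supplies the half-line \<open>u \<le> 0\<close>.\<close>
  have 2: "integrable lborel (\<lambda>u. ?h (0 + (- 1) * u))"
    by (rule lborel_integrable_real_affine[OF 1]) simp
  have 3: "exp (- c * \<bar>u\<bar>) \<le> ?h u + ?h (0 + (- 1) * u)" for u
    by (auto simp: abs_if indicator_def)
  show ?thesis
    by (rule Bochner_Integration.integrable_bound[OF Bochner_Integration.integrable_add[OF 1 2]])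
      (use 3 in \<open>auto intro!: AE_I2 order_trans[OF _ abs_ge_self]\<close>)
qed

text \<open>The norm dominates the average of the absolute coordinates, so the function lies below a
  product of one-dimensional exponentials, whose integral factorises.\<close>

lemma integrable_exp_neg_norm:
  "integrable lborel (\<lambda>x::'a::euclidean_space. exp (- norm x))"
proof -
  let ?d = "real DIM('a)"
  have d: "?d > 0" by simp
  have 2: "exp (- norm x) \<le> (\<Prod>b\<in>Basis. exp (- (1 / ?d) * \<bar>x \<bullet> b\<bar>))" for x :: 'a
  proof -
    have "(\<Sum>b\<in>Basis. \<bar>x \<bullet> b\<bar>) \<le> (\<Sum>b\<in>(Basis::'a set). norm x)"
      by (intro sum_mono Basis_le_norm)
    hence "(\<Sum>b\<in>Basis. \<bar>x \<bullet> b\<bar> / ?d) \<le> norm x"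
      using d by (simp add: sum_divide_distrib[symmetric] divide_simps mult.commute)
    hence "exp (- norm x) \<le> exp (\<Sum>b\<in>Basis. - (1 / ?d) * \<bar>x \<bullet> b\<bar>)"
      by (simp add: sum_negf)
    also have "\<dots> = (\<Prod>b\<in>Basis. exp (- (1 / ?d) * \<bar>x \<bullet> b\<bar>))"
      by (rule exp_sum) simp
    finally show ?thesis .
  qed
  have "integrable lborel (\<lambda>u::real. exp (- (1 / ?d) * \<bar>u\<bar>))"
    by (rule integrable_exp_neg_abs) simp
  hence fin: "(\<integral>\<^sup>+u. ennreal (exp (- (1 / ?d) * \<bar>u\<bar>)) \<partial>lborel) < \<infinity>"
    unfolding integrable_iff_bounded by simp
  have "(\<integral>\<^sup>+(x::'a). (\<Prod>b\<in>Basis. ennreal (exp (- (1 / ?d) * \<bar>x \<bullet> b\<bar>))) \<partial>lborel)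
      = (\<Prod>b\<in>(Basis::'a set). \<integral>\<^sup>+u. ennreal (exp (- (1 / ?d) * \<bar>u\<bar>)) \<partial>lborel)"
    by (rule nn_integral_lborel_prod[where f="\<lambda>_ u. ennreal (exp (- (1 / ?d) * \<bar>u\<bar>))"]) auto
  also have "\<dots> < \<infinity>" using fin by (simp add: power_less_top_ennreal)
  finally have "(\<integral>\<^sup>+(x::'a). ennreal (\<Prod>b\<in>Basis. exp (- (1 / ?d) * \<bar>x \<bullet> b\<bar>)) \<partial>lborel) < \<infinity>"
    by (simp add: prod_ennreal)
  hence "integrable lborel (\<lambda>x::'a. \<Prod>b\<in>Basis. exp (- (1 / ?d) * \<bar>x \<bullet> b\<bar>))"
    by (intro integrableI_nonneg) (auto intro!: prod_nonneg)
  thus ?thesis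
    by (rule Bochner_Integration.integrable_bound) (use 2 in \<open>auto intro!: AE_I2 order_trans[OF _ abs_ge_self]\<close>)
qed

text \<open>Raise the hypothesis to the power \<open>r\<close>, divide by \<open>2\<^sup>n n!\<close> and sum over \<open>n\<close>.\<close>

lemma exp_decay_of_moment_bounds:
  fixes u V K A r :: real
  assumes u: "u \<ge> 0" and V: "V \<ge> 0" and A: "A > 0" and r: "r \<ge> 1"
    and bound: "\<And>n::nat. u ^ n * V \<le> K * A ^ n * fact n powr (1 / r)"
  shows "V \<le> 2 * K * exp (- ((1 / A) powr r / (2 * r)) * u powr r)"
proof -
  have K: "K \<ge> 0" using bound[of 0] V by simp
  define q where "q = (u / A) powr r"
  have q: "q \<ge> 0" by (simp add: q_def)
  have 1: "q ^ n * V powr r \<le> K powr r * fact n" for n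
  proof -
    have "(u / A) ^ n * V \<le> K * fact n powr (1 / r)"
      using bound[of n] A by (simp add: power_divide field_simps)
    hence "((u / A) ^ n * V) powr r \<le> (K * fact n powr (1 / r)) powr r"
      using u V A r by (intro powr_mono2) auto
    moreover have "((u / A) ^ n) powr r = q ^ n"
      using u A by (cases "u = 0"; cases "n = 0") (auto simp: q_def powr_powr mult.commute zero_power simp flip: powr_realpow)
    ultimately show ?thesis
      using K V u A r by (simp add: powr_mult powr_powr)
  qed
  have "(\<lambda>n. (q / 2) ^ n /\<^sub>R fact n * V powr r) sums (exp (q / 2) * V powr r)"
    by (intro sums_mult2 exp_converges)
  moreover have "(\<lambda>n. K powr r * (1 / 2) ^ n) sums (K powr r * 2)"
    using sums_mult[OF geometric_sums[of "1/2 :: real"]] by fastforce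
  ultimately have "exp (q / 2) * V powr r \<le> K powr r * 2"
  proof (rule sums_le[rotated])
    fix n
    have "(q / 2) ^ n /\<^sub>R fact n * V powr r = (q ^ n * V powr r) / (2 ^ n * fact n)"
      by (simp add: field_simps power_divide)
    also have "\<dots> \<le> (K powr r * fact n) / (2 ^ n * fact n)"
      by (intro divide_right_mono 1) auto
    finally show "(q / 2) ^ n /\<^sub>R fact n * V powr r \<le> K powr r * (1 / 2) ^ n"
      by (simp add: field_simps)
  qed
  \<comment> \<open>The \<open>r\<close>-th root leads back from \<open>V powr r\<close> to
    \<open>V\<close>, and it halves no further constant than the \<open>2\<close> of the geometric
    series, bounded by \<open>2 powr (1 / r) \<le> 2\<close>.\<close>
  hence "(exp (q / 2) * V powr r) powr (1 / r) \<le> (K powr r * 2) powr (1 / r)"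
    using r by (intro powr_mono2) auto
  hence "exp (q / (2 * r)) * V \<le> K * 2 powr (1 / r)"
    using V K r by (simp add: powr_mult powr_powr) (simp add: powr_def mult.commute)
  also have "\<dots> \<le> K * 2"
    using r K powr_mono[of "1/r" 1 "2::real"] by (intro mult_left_mono) auto
  finally have "V \<le> 2 * K * exp (- (q / (2 * r)))"
    by (simp add: exp_minus field_simps)
  also have "q / (2 * r) = ((1 / A) powr r / (2 * r)) * u powr r"
    using A u by (simp add: q_def powr_divide)
  finally show ?thesis by simp
qed

text \<open>Young's inequality with a prescribed coefficient of \<open>x powr r\<close>. Either
  \<open>y \<le> c * x powr (r - 1)\<close> and the first term suffices, or the reverse inequality,
  solved for \<open>x\<close>, yields the second term and the value of \<open>b\<close>.\<close>

lemma young_powr: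
  fixes r :: real
  assumes r: "r > 1" and c: "c > 0"
  obtains b where "b > 0" "\<And>x y. x \<ge> 0 \<Longrightarrow> y \<ge> 0 \<Longrightarrow> x * y \<le> c * x powr r + b * y powr (r / (r - 1))"
proof -
  define b where "b = (1 / c) powr (1 / (r - 1))"
  show thesis
  proof
    show b0: "b > 0" using c by (simp add: b_def)
    fix x y :: real assume x: "x \<ge> 0" and y: "y \<ge> 0"
    show "x * y \<le> c * x powr r + b * y powr (r / (r - 1))"
    proof (cases "y \<le> c * x powr (r - 1)")
      case True
      have "x * y \<le> x * (c * x powr (r - 1))" using True x by (intro mult_left_mono)
      also have "\<dots> = c * x powr r"
        using x by (cases "x = 0") (auto simp: powr_mult_base[of x] r)
      finally show ?thesis by (smt (verit) b0 mult_nonneg_nonneg powr_ge_zero)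
    next
      case False
      have "(x powr (r - 1)) powr (1 / (r - 1)) \<le> (y / c) powr (1 / (r - 1))"
        using False c r by (intro powr_mono2) (auto simp: field_simps)
      hence "x \<le> b * y powr (1 / (r - 1))"
        using x y r c by (simp add: powr_powr b_def powr_divide)
      hence "x * y \<le> b * y powr (1 / (r - 1)) * y" using y by (intro mult_right_mono)
      also have "\<dots> = b * y powr (r / (r - 1))"
      proof -
        have "1 + 1 / (r - 1) = r / (r - 1)" using r by (simp add: field_simps)
        thus ?thesis using y powr_mult_base[of y "1 / (r - 1)"] by (cases "y = 0") (auto simp: mult_ac)
      qed
      finally show ?thesis using c by (smt (verit) mult_nonneg_nonneg powr_ge_zero)
    qed
  qed
qed

section \<open>Integrals and the Fourier-Laplace transform\<close>

lemma integrable_lborel_shift: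
  fixes f :: "'a::euclidean_space \<Rightarrow> 'b::{banach, second_countable_topology}"
  assumes "integrable lborel f"
  shows "integrable lborel (\<lambda>x. f (x + c))"
proof -
  have "integrable (distr lborel borel ((+) c)) f"
    using assms by (simp add: lborel_distr_plus)
  hence "integrable lborel (\<lambda>x. f (c + x))"
    by (subst (asm) integrable_distr_eq) (use assms in auto)
  thus ?thesis by (simp add: add.commute)
qed

lemma lborel_integral_shift:
  fixes f :: "'a::euclidean_space \<Rightarrow> 'b::{banach, second_countable_topology}"
  assumes "f \<in> borel_measurable borel"
  shows "(LINT x|lborel. f (x + c)) = (LINT x|lborel. f x)"
proof -
  have "(LINT x|lborel. f x) = (LINT x|distr lborel borel ((+) c). f x)"
    by (simp add: lborel_distr_plus)
  also have "\<dots> = (LINT x|lborel. f (c + x))"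
    by (rule integral_distr) (use assms in auto)
  finally show ?thesis by (simp add: add.commute)
qed

text \<open>Translation invariance makes the integrals of all difference quotients of \<open>F\<close> vanish.\<close>

lemma integral_directional_derivative_eq_0:
  fixes F :: "'a::euclidean_space \<Rightarrow> complex"
  assumes dF: "\<And>x. (F has_derivative F' x) (at x)"
    and F: "\<And>x. norm (F x) \<le> K * exp (- norm x)"
    and F'v: "\<And>x. norm (F' x v) \<le> K * exp (- norm x)"
    and meas: "(\<lambda>x. F' x v) \<in> borel_measurable borel"
  shows "(LINT x|lborel. F' x v) = 0"
proof -
  have "continuous_on UNIV F"
    using dF by (meson continuous_at_imp_continuous_on has_derivative_continuous)
  hence mF [measurable]: "F \<in> borel_measurable borel"
    by (rule borel_measurable_continuous_onI)
  have iF: "integrable lborel F"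
    by (rule Bochner_Integration.integrable_bound[OF integrable_mult_right[OF integrable_exp_neg_norm, of K]])
      (use F in \<open>auto intro!: AE_I2 order_trans[OF _ abs_ge_self]\<close>)
  have K: "K \<ge> 0" using order_trans[OF norm_ge_zero F[of 0]] by simp
  define e where "e n = inverse (real (Suc n))" for n
  have e: "0 < e n" "e n \<le> 1" for n by (auto simp: e_def inverse_le_1_iff)
  define h where "h n x = (F (x + e n *\<^sub>R v) - F x) /\<^sub>R e n" for n x
  have dline: "((\<lambda>u. F (x + u *\<^sub>R v)) has_derivative (\<lambda>d. F' (x + u *\<^sub>R v) (d *\<^sub>R v))) (at u within S)" for x u S
    by (rule has_derivative_compose[OF _ dF]) (auto intro!: derivative_eq_intros)
  have lin: "F' x (d *\<^sub>R v) = d *\<^sub>R F' x v" for x d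
    using dF[of x] by (simp add: has_derivative_linear linear_scale)
  \<comment> \<open>The mean value inequality along the segment dominates all difference quotients
    at once: steps \<open>e n \<le> 1\<close> move the point by at most \<open>norm v\<close>, which
    costs the factor \<open>exp (norm v)\<close>.\<close>
  have hb: "norm (h n x) \<le> K * exp (norm v) * exp (- norm x)" for n x
  proof -
    have "norm (F (x + e n *\<^sub>R v) - F (x + 0 *\<^sub>R v)) \<le> K * exp (norm v) * exp (- norm x) * norm (e n - 0)"
    proof (rule differentiable_bound[of "{0..e n}" "\<lambda>u. F (x + u *\<^sub>R v)" "\<lambda>u d. F' (x + u *\<^sub>R v) (d *\<^sub>R v)"])
      show "onorm (\<lambda>d. F' (x + u *\<^sub>R v) (d *\<^sub>R v)) \<le> K * exp (norm v) * exp (- norm x)" if u: "u \<in> {0..e n}" for u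
      proof (rule onorm_le)
        fix d :: real
        have "norm x \<le> norm (x + u *\<^sub>R v) + norm (u *\<^sub>R v)"
          using norm_triangle_sub[of x "x + u *\<^sub>R v"] by simp
        also have "norm (u *\<^sub>R v) \<le> norm v"
          using u e[of n] by (auto intro: mult_left_le_one_le)
        finally have "exp (- norm (x + u *\<^sub>R v)) \<le> exp (norm v) * exp (- norm x)"
          by (simp flip: exp_add)
        hence "norm (F' (x + u *\<^sub>R v) v) \<le> K * (exp (norm v) * exp (- norm x))"
          using F'v[of "x + u *\<^sub>R v"] K by (meson mult_left_mono order_trans)
        thus "norm (F' (x + u *\<^sub>R v) (d *\<^sub>R v)) \<le> K * exp (norm v) * exp (- norm x) * norm d"
          unfolding lin by (simp add: mult.commute[of _ "\<bar>d\<bar>"] mult_left_mono mult.assoc)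
      qed
    qed (use e[of n] dline in auto)
    thus ?thesis using e[of n] by (simp add: h_def divide_simps mult_ac)
  qed
  have lim: "(\<lambda>n. h n x) \<longlonglongrightarrow> F' x v" for x
  proof -
    have "((\<lambda>u. F (x + u *\<^sub>R v)) has_vector_derivative F' x v) (at 0)"
      unfolding has_vector_derivative_def using dline[of x 0 UNIV] by (simp add: lin)
    hence "((\<lambda>u. norm (F (x + u *\<^sub>R v) - F x - u *\<^sub>R F' x v) / norm u) \<longlongrightarrow> 0) (at 0)"
      by (simp add: has_vector_derivative_def has_derivative_at)
    moreover have "\<forall>\<^sub>F u in at 0. norm (F (x + u *\<^sub>R v) - F x - u *\<^sub>R F' x v) / norm u =
        norm ((F (x + u *\<^sub>R v) - F x) /\<^sub>R u - F' x v)"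
    proof (rule eventually_at_filter[THEN iffD2, OF always_eventually], intro allI impI)
      fix u :: real assume u: "u \<noteq> 0"
      hence "(F (x + u *\<^sub>R v) - F x) /\<^sub>R u - F' x v = (F (x + u *\<^sub>R v) - F x - u *\<^sub>R F' x v) /\<^sub>R u"
        by (simp add: scaleR_right_diff_distrib)
      thus "norm (F (x + u *\<^sub>R v) - F x - u *\<^sub>R F' x v) / norm u =
          norm ((F (x + u *\<^sub>R v) - F x) /\<^sub>R u - F' x v)"
        by (simp add: divide_inverse mult.commute)
    qed
    ultimately have "((\<lambda>u. norm ((F (x + u *\<^sub>R v) - F x) /\<^sub>R u - F' x v)) \<longlongrightarrow> 0) (at 0)"
      by (rule Lim_transform_eventually)
    hence "((\<lambda>u. (F (x + u *\<^sub>R v) - F x) /\<^sub>R u) \<longlongrightarrow> F' x v) (at 0)"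
      by (simp add: tendsto_norm_zero_iff Lim_null[of _ "F' x v"])
    moreover have "filterlim e (at 0) sequentially"
      unfolding filterlim_at using e LIMSEQ_inverse_real_of_nat
      by (auto simp: e_def[abs_def])
    ultimately show ?thesis
      unfolding h_def by (rule filterlim_compose)
  qed
  have "(\<lambda>n. LINT x|lborel. h n x) \<longlonglongrightarrow> (LINT x|lborel. F' x v)"
  proof (rule integral_dominated_convergence)
    show "integrable lborel (\<lambda>x. K * exp (norm v) * exp (- norm x))"
      by (intro integrable_mult_right integrable_exp_neg_norm)
  qed (use meas lim hb in \<open>auto simp: h_def\<close>)
  moreover have "(LINT x|lborel. h n x) = 0" for n
    unfolding h_def using iF integrable_lborel_shift[OF iF]
    by (simp add: lborel_integral_shift[OF mF])
  ultimately show ?thesis by (simp add: LIMSEQ_const_iff)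
qed

text \<open>A non-integrable \<open>f\<close> has Bochner integral \<open>0\<close> by convention;
  the majorant being nonnegative, the bound covers this case too.\<close>

lemma norm_integral_le_dominated:
  fixes f :: "'a \<Rightarrow> 'b::{banach, second_countable_topology}"
  assumes h: "integrable M h" and le: "\<And>x. norm (f x) \<le> h x"
  shows "norm (LINT x|M. f x) \<le> (LINT x|M. h x)"
proof (cases "integrable M f")
  case True
  have "norm (LINT x|M. f x) \<le> (LINT x|M. norm (f x))" by (rule integral_norm_bound)
  also have "\<dots> \<le> (LINT x|M. h x)" using True h le by (intro integral_mono) auto
  finally show ?thesis .
next
  case False
  have "0 \<le> h x" for x using order_trans[OF norm_ge_zero le] .
  thus ?thesis using False by (simp add: not_integrable_integral_eq Bochner_Integration.integral_nonneg)
qed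

text \<open>Differentiation under the integral sign. By Cauchy's inequality a majorant of
  \<open>f\<close> on a disc also bounds the derivative on the disc of radius smaller by one, hence
  the difference quotients there, and dominated convergence applies.\<close>

lemma holomorphic_integral:
  fixes f :: "complex \<Rightarrow> 'a \<Rightarrow> complex"
  assumes meas: "\<And>s. f s \<in> borel_measurable M"
    and hol: "\<And>x. (\<lambda>s. f s x) holomorphic_on UNIV"
    and dom: "\<And>R. \<exists>h. integrable M h \<and> (\<forall>s x. norm s \<le> R \<longrightarrow> norm (f s x) \<le> h x)"
  shows "(\<lambda>s. LINT x|M. f s x) holomorphic_on UNIV"
proof -
  have "((\<lambda>s. LINT x|M. f s x) has_field_derivative (LINT x|M. deriv (\<lambda>s. f s x) s0)) (at s0)" for s0
    unfolding DERIV_def tendsto_at_iff_sequentially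
  proof (intro allI impI)
    fix X :: "nat \<Rightarrow> complex" assume X: "\<forall>i. X i \<in> UNIV - {0}" and X0: "X \<longlonglongrightarrow> 0"
    \<comment> \<open>The points \<open>s0 + X n\<close> will stay within distance \<open>1\<close>
      of \<open>s0\<close>, and the circles in Cauchy's inequality add another
      \<open>1\<close>.\<close>
    obtain h where h: "integrable M h" "\<And>s x. norm s \<le> norm s0 + 2 \<Longrightarrow> norm (f s x) \<le> h x"
      using dom by blast
    have d: "((\<lambda>s. f s x) has_field_derivative deriv (\<lambda>s. f s x) u) (at u)" for x u
      using hol[of x] by (auto intro: holomorphic_derivI)
    have db: "norm (deriv (\<lambda>s. f s x) u) \<le> h x" if u: "u \<in> cball s0 1" for u x
    proof -
      have "norm ((deriv ^^ 1) (\<lambda>s. f s x) u) \<le> fact 1 * h x / 1 ^ 1"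
      proof (rule Cauchy_inequality)
        show "(\<lambda>s. f s x) holomorphic_on ball u 1" using hol holomorphic_on_subset by blast
        show "continuous_on (cball u 1) (\<lambda>s. f s x)"
          by (rule continuous_on_subset[OF holomorphic_on_imp_continuous_on[OF hol]]) simp
        fix w assume w: "norm (u - w) = 1"
        have "norm w \<le> norm s0 + norm (u - s0) + norm (u - w)"
          using norm_triangle_sub[of w u] norm_triangle_sub[of u s0] by (simp add: norm_minus_commute)
        with u w show "norm (f w x) \<le> h x"
          by (intro h) (auto simp: dist_norm norm_minus_commute)
      qed auto
      thus ?thesis by simp
    qed
    obtain N where N: "\<And>n. n \<ge> N \<Longrightarrow> norm (X n) < 1"
      using LIMSEQ_D[OF X0, of 1] by auto
    define q where "q n x = (f (s0 + X (n + N)) x - f s0 x) / X (n + N)" for n x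
    have qb: "norm (q n x) \<le> h x" for n x
    proof -
      have "norm (f (s0 + X (n + N)) x - f s0 x) \<le> h x * norm (s0 + X (n + N) - s0)"
        by (rule field_differentiable_bound[of "cball s0 1" "\<lambda>s. f s x" "deriv (\<lambda>s. f s x)"])
          (use d db N[of "n + N"] in \<open>auto simp: dist_norm intro: has_field_derivative_at_within\<close>)
      thus ?thesis using X by (simp add: q_def norm_divide divide_simps)
    qed
    have ql: "(\<lambda>n. q n x) \<longlonglongrightarrow> deriv (\<lambda>s. f s x) s0" for x
    proof -
      have "((\<lambda>y. (f (s0 + y) x - f s0 x) / y) \<circ> X) \<longlonglongrightarrow> deriv (\<lambda>s. f s x) s0"
        using d[of x s0] X X0 unfolding DERIV_def tendsto_at_iff_sequentially by blast
      thus ?thesis unfolding q_def o_def by (rule LIMSEQ_ignore_initial_segment)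
    qed
    have int: "integrable M (f s)" if "norm s \<le> norm s0 + 2" for s
      by (rule Bochner_Integration.integrable_bound[OF h(1) meas])
        (use h(2)[OF that] in \<open>auto intro!: AE_I2 order_trans[OF _ abs_ge_self]\<close>)
    have qm [measurable]: "q n \<in> borel_measurable M" for n
      unfolding q_def using meas by measurable
    have "(\<lambda>n. LINT x|M. q n x) \<longlonglongrightarrow> (LINT x|M. deriv (\<lambda>s. f s x) s0)"
    proof (rule integral_dominated_convergence[OF _ _ h(1)])
      \<comment> \<open>Measurability of the derivative comes from its being a pointwise limit of
        difference quotients.\<close>
      show "(\<lambda>x. deriv (\<lambda>s. f s x) s0) \<in> borel_measurable M"
        by (rule borel_measurable_LIMSEQ_metric[OF qm ql])
    qed (use ql qb in auto)
    moreover have "(LINT x|M. q n x) =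
        ((LINT x|M. f (s0 + X (n + N)) x) - (LINT x|M. f s0 x)) / X (n + N)" for n
    proof -
      have "norm (s0 + X (n + N)) \<le> norm s0 + 2"
        using norm_triangle_ineq[of s0 "X (n + N)"] N[of "n + N"] by simp
      thus ?thesis unfolding q_def by (simp add: int)
    qed
    ultimately have "(\<lambda>n. ((LINT x|M. f (s0 + X (n + N)) x) - (LINT x|M. f s0 x)) / X (n + N))
        \<longlonglongrightarrow> (LINT x|M. deriv (\<lambda>s. f s x) s0)" by simp
    from LIMSEQ_offset[OF this]
    show "((\<lambda>y. ((LINT x|M. f (s0 + y) x) - (LINT x|M. f s0 x)) / y) \<circ> X)
        \<longlonglongrightarrow> (LINT x|M. deriv (\<lambda>s. f s x) s0)"
      by (simp add: o_def)
  qed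
  thus ?thesis by (auto simp: holomorphic_on_open field_differentiable_def)
qed

text \<open>Young's inequality is used twice, each time with half of the rate \<open>a\<close>:
  against \<open>x * 1\<close> to gain the integrable factor \<open>exp (- x)\<close>, and against
  \<open>x * (2 * pi * y)\<close> to absorb the exponential growth of the Fourier-Laplace
  kernel.\<close>

lemma exp_young:
  fixes r a :: real
  assumes r: "r > 1" and a: "a > 0"
  obtains b E where "b > 0" "E > 0"
    "\<And>x y. x \<ge> 0 \<Longrightarrow> y \<ge> 0 \<Longrightarrow>
       exp (- a * x powr r + 2 * pi * x * y) \<le> E * exp (b * y powr (r / (r - 1))) * exp (- x)"
proof -
  obtain b where b: "b > 0" "\<And>x y. x \<ge> 0 \<Longrightarrow> y \<ge> 0 \<Longrightarrow> x * y \<le> a / 2 * x powr r + b * y powr (r / (r - 1))"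
    using young_powr[OF r, of "a / 2"] a by auto
  show thesis
  proof
    show "b * (2 * pi) powr (r / (r - 1)) > 0" "exp b > 0" using b by auto
    fix x y :: real assume xy: "x \<ge> 0" "y \<ge> 0"
    have "x * 1 \<le> a / 2 * x powr r + b" "x * (2 * pi * y) \<le> a / 2 * x powr r + b * (2 * pi * y) powr (r / (r - 1))"
      using b(2)[of x 1] b(2)[of x "2 * pi * y"] xy by auto
    moreover have "(2 * pi * y) powr (r / (r - 1)) = (2 * pi) powr (r / (r - 1)) * y powr (r / (r - 1))"
      using xy by (simp add: powr_mult)
    ultimately have "- a * x powr r + 2 * pi * x * y \<le> b + b * (2 * pi) powr (r / (r - 1)) * y powr (r / (r - 1)) - x"
      by (simp add: algebra_simps)
    thus "exp (- a * x powr r + 2 * pi * x * y) \<le>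
        exp b * exp (b * (2 * pi) powr (r / (r - 1)) * y powr (r / (r - 1))) * exp (- x)"
      by (simp flip: exp_add)
  qed
qed

section \<open>Decay of Gelfand-Shilov functions\<close>

lemma exists_large_component:
  fixes x :: "real^'d::finite"
  obtains k where "norm x \<le> real CARD('d) * \<bar>x $ k\<bar>"
proof -
  obtain k where k: "\<And>i. \<bar>x $ i\<bar> \<le> \<bar>x $ k\<bar>"
  proof -
    have "Max (range (\<lambda>i. \<bar>x $ i\<bar>)) \<in> range (\<lambda>i. \<bar>x $ i\<bar>)"
      by (rule Max_in) auto
    then obtain k where "Max (range (\<lambda>i. \<bar>x $ i\<bar>)) = \<bar>x $ k\<bar>" by blast
    thus thesis by (intro that[of k]) (metis Max_ge finite_class.finite_UNIV finite_imageI rangeI)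
  qed
  have "norm x \<le> (\<Sum>i\<in>UNIV. \<bar>x $ i\<bar>)" by (rule norm_le_l1_cart)
  also have "\<dots> \<le> (\<Sum>i\<in>(UNIV :: 'd set). \<bar>x $ k\<bar>)" by (intro sum_mono k)
  finally show thesis by (intro that[of k]) simp
qed

lemma exp_neg_powr_component_le:
  fixes x :: "real^'d::finite"
  assumes "r > 0" "a > 0" "norm x \<le> real CARD('d) * u"
  shows "exp (- a * u powr r) \<le> exp (- (a * (1 / real CARD('d)) powr r) * norm x powr r)"
proof -
  have "(norm x / real CARD('d)) powr r \<le> u powr r"
    using assms by (intro powr_mono2) (auto simp: field_simps)
  hence "(1 / real CARD('d)) powr r * norm x powr r \<le> u powr r"
    by (simp add: powr_divide)
  thus ?thesis using assms by simp
qed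

text \<open>Monomials in the largest coordinate of \<open>x\<close> alone turn the defining
  estimates into the moment bounds of \<open>exp_decay_of_moment_bounds\<close>. The dependence on
  \<open>\<beta>\<close> stays in the prefactor, so one rate \<open>a\<close> serves all
  derivatives.\<close>

lemma gelfand_shilov_decay:
  fixes g :: "real^'d::finite \<Rightarrow> complex"
  assumes r: "r > 1" and g: "g \<in> gelfand_shilov (1 / r)"
  obtains D a B c where "has_partials g D" "a > 0" "B > 0" "c > 0"
    "\<And>\<beta> x. norm (D \<beta> x) \<le> c * B ^ (\<Sum>j\<in>UNIV. \<beta> j) * multi_fact \<beta> powr (1 / r) * exp (- a * norm x powr r)"
proof -
  obtain D A B c where D: "has_partials g D" and pos: "A > 0" "B > 0" "c > 0"
    and bound: "\<And>x \<alpha> \<beta>. norm (multi_monom x \<alpha> *\<^sub>R D \<beta> x) \<le>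
          c * A ^ (\<Sum>j\<in>UNIV. \<alpha> j) * B ^ (\<Sum>j\<in>UNIV. \<beta> j) * multi_fact \<alpha> powr (1 / r) * multi_fact \<beta> powr (1 / r)"
    using g unfolding gelfand_shilov_def by blast
  define a where "a = (1 / A) powr r / (2 * r)"
  have a: "a > 0" using pos r by (simp add: a_def)
  show thesis
  proof (rule that[of D "a * (1 / real CARD('d)) powr r" B "2 * c"])
    show "has_partials g D" "B > 0" "2 * c > 0" "a * (1 / real CARD('d)) powr r > 0"
      using D pos a by auto
    fix \<beta> :: "'d \<Rightarrow> nat" and x :: "real^'d"
    obtain k where k: "norm x \<le> real CARD('d) * \<bar>x $ k\<bar>" by (rule exists_large_component)
    let ?K = "c * B ^ (\<Sum>j\<in>UNIV. \<beta> j) * multi_fact \<beta> powr (1 / r)"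
    have "norm (D \<beta> x) \<le> 2 * ?K * exp (- ((1 / A) powr r / (2 * r)) * \<bar>x $ k\<bar> powr r)"
    proof (rule exp_decay_of_moment_bounds)
      fix n :: nat
      define \<alpha> where "\<alpha> = (\<lambda>i. if i = k then n else 0)"
      have "multi_monom x \<alpha> = (x $ k) ^ n" "multi_fact \<alpha> = fact n" "(\<Sum>j\<in>UNIV. \<alpha> j) = n"
        by (simp_all add: multi_monom_def multi_fact_def \<alpha>_def if_distrib cong: if_cong)
      thus "\<bar>x $ k\<bar> ^ n * norm (D \<beta> x) \<le> ?K * A ^ n * fact n powr (1 / r)"
        using bound[of x \<alpha> \<beta>] by (simp add: power_abs mult_ac)
    qed (use pos r in auto)
    also have "\<dots> \<le> 2 * ?K * exp (- (a * (1 / real CARD('d)) powr r) * norm x powr r)"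
      using exp_neg_powr_component_le[OF _ a k, of r] r pos by (intro mult_left_mono) (auto simp: a_def)
    finally show "norm (D \<beta> x) \<le> 2 * c * B ^ (\<Sum>j\<in>UNIV. \<beta> j) * multi_fact \<beta> powr (1 / r) *
        exp (- (a * (1 / real CARD('d)) powr r) * norm x powr r)" by (simp add: mult_ac)
  qed
qed

section \<open>The Fourier-Laplace transform\<close>

definition cdot :: "real^'d::finite \<Rightarrow> complex^'d \<Rightarrow> complex" where
  "cdot x \<zeta> = (\<Sum>j\<in>UNIV. of_real (x $ j) * \<zeta> $ j)"

text \<open>The phase pairs \<open>x\<close> and \<open>\<zeta>\<close> bilinearly, without
  conjugation, which makes the integrand holomorphic in \<open>\<zeta>\<close>.\<close>

definition fourier_laplace :: "(real^'d::finite \<Rightarrow> complex) \<Rightarrow> complex^'d \<Rightarrow> complex" where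
  "fourier_laplace f \<zeta> = (LINT x|lborel. f x * exp (- 2 * pi * \<i> * cdot x \<zeta>))"

definition Re_vec :: "complex^'d::finite \<Rightarrow> real^'d" where
  "Re_vec \<zeta> = (\<chi> j. Re (\<zeta> $ j))"

lemma cdot_cvec: "cdot x (cvec \<xi>) = of_real (x \<bullet> \<xi>)"
  by (simp add: cdot_def cvec_def inner_vec_def)

lemma cdot_add: "cdot x (\<zeta> + \<eta>) = cdot x \<zeta> + cdot x \<eta>"
  by (simp add: cdot_def algebra_simps sum.distrib)

lemma cdot_axis: "cdot x (axis j s) = of_real (x $ j) * s"
  by (simp add: cdot_def axis_def if_distrib cong: if_cong)

lemma cdot_axis_left: "cdot (axis k 1) \<zeta> = \<zeta> $ k"
  by (simp add: cdot_def axis_def if_distrib if_distribR cong: if_cong)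

lemma norm_exp_cdot: "norm (exp (- 2 * pi * \<i> * cdot x \<zeta>)) = exp (2 * pi * (x \<bullet> Im_vec \<zeta>))"
  by (simp add: cdot_def Im_vec_def inner_vec_def)

lemma fourier_eq_fourier_laplace: "fourier f \<xi> = fourier_laplace f (cvec \<xi>)"
  by (simp add: fourier_def fourier_laplace_def cdot_cvec cis_conv_exp mult_ac)

lemma bounded_linear_cdot: "bounded_linear (\<lambda>x. cdot x \<zeta>)"
  unfolding cdot_def
  by (intro bounded_linear_sum bounded_linear_mult_left[THEN bounded_linear_compose]
      bounded_linear_of_real[THEN bounded_linear_compose] bounded_linear_vec_nth)

lemma continuous_on_cdot [continuous_intros]:
  assumes "continuous_on A f" "continuous_on A h"
  shows "continuous_on A (\<lambda>x. cdot (f x) (h x))"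
  unfolding cdot_def by (intro continuous_intros assms)

text \<open>Here and below, the hypothesis \<open>young\<close> is an instance of the conclusion of \<open>exp_young\<close>.\<close>

lemma fourier_laplace_integrand_le:
  fixes x :: "real^'d::finite"
  assumes young: "\<And>x y. x \<ge> 0 \<Longrightarrow> y \<ge> 0 \<Longrightarrow>
       exp (- a * x powr r + 2 * pi * x * y) \<le> E * exp (b * y powr q) * exp (- x)"
    and f: "norm z \<le> K * exp (- a * norm x powr r)"
  shows "norm (z * exp (- 2 * pi * \<i> * cdot x \<zeta>)) \<le> K * E * exp (b * norm (Im_vec \<zeta>) powr q) * exp (- norm x)"
proof -
  have K: "K \<ge> 0"
    using order_trans[OF norm_ge_zero f] by (simp add: zero_le_mult_iff)
  have "x \<bullet> Im_vec \<zeta> \<le> norm x * norm (Im_vec \<zeta>)" by (rule norm_cauchy_schwarz)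
  hence "norm (exp (- 2 * pi * \<i> * cdot x \<zeta>)) \<le> exp (2 * pi * norm x * norm (Im_vec \<zeta>))"
    unfolding norm_exp_cdot by simp
  hence "norm z * norm (exp (- 2 * pi * \<i> * cdot x \<zeta>)) \<le>
      (K * exp (- a * norm x powr r)) * exp (2 * pi * norm x * norm (Im_vec \<zeta>))"
    using f K by (intro mult_mono) auto
  also have "\<dots> = K * exp (- a * norm x powr r + 2 * pi * norm x * norm (Im_vec \<zeta>))"
    by (simp only: exp_add mult.assoc)
  also have "\<dots> \<le> K * (E * exp (b * norm (Im_vec \<zeta>) powr q) * exp (- norm x))"
    using K by (intro mult_left_mono young) auto
  finally show ?thesis by (simp add: norm_mult mult_ac)
qed


lemma fourier_laplace_bound:
  fixes f :: "real^'d::finite \<Rightarrow> complex"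
  assumes young: "\<And>x y. x \<ge> 0 \<Longrightarrow> y \<ge> 0 \<Longrightarrow>
       exp (- a * x powr r + 2 * pi * x * y) \<le> E * exp (b * y powr q) * exp (- x)"
    and f: "\<And>x. norm (f x) \<le> K * exp (- a * norm x powr r)"
  shows "norm (fourier_laplace f \<zeta>) \<le>
    K * E * exp (b * norm (Im_vec \<zeta>) powr q) * (LINT x|lborel. exp (- norm (x :: real^'d)))"
proof -
  note le = fourier_laplace_integrand_le[OF young f]
  have i: "integrable lborel (\<lambda>x::real^'d. K * E * exp (b * norm (Im_vec \<zeta>) powr q) * exp (- norm x))"
    by (intro integrable_mult_right integrable_exp_neg_norm)
  have "norm (fourier_laplace f \<zeta>) \<le> (LINT x|lborel. K * E * exp (b * norm (Im_vec \<zeta>) powr q) * exp (- norm (x :: real^'d)))"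
    unfolding fourier_laplace_def
    by (rule norm_integral_le_dominated[OF i le])
  thus ?thesis by simp
qed

text \<open>Integration by parts: the derivative of \<open>D \<beta>\<close> times the kernel in
  direction \<open>k\<close> has integral zero, and the product rule splits it into the two
  transforms compared here.\<close>

lemma fourier_laplace_partial:
  fixes D :: "('d::finite \<Rightarrow> nat) \<Rightarrow> real^'d \<Rightarrow> complex"
  assumes D: "has_partials g D"
    and young: "\<And>x y. x \<ge> 0 \<Longrightarrow> y \<ge> 0 \<Longrightarrow>
       exp (- a * x powr r + 2 * pi * x * y) \<le> E * exp (b * y powr q) * exp (- x)"
    and decay: "\<And>\<beta> x. norm (D \<beta> x) \<le> K \<beta> * exp (- a * norm x powr r)"
  shows "fourier_laplace (D (\<beta>(k := Suc (\<beta> k)))) \<zeta> = 2 * pi * \<i> * \<zeta> $ k * fourier_laplace (D \<beta>) \<zeta>"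
proof -
  let ?e = "\<lambda>x. exp (- 2 * pi * \<i> * cdot x \<zeta>)"
  let ?\<beta> = "\<beta>(k := Suc (\<beta> k))"
  let ?M = "E * exp (b * norm (Im_vec \<zeta>) powr q)"
  have dD: "(D \<beta> has_derivative (\<lambda>h. \<Sum>j\<in>UNIV. (h $ j) *\<^sub>R D (\<beta>(j := Suc (\<beta> j))) x)) (at x)" for \<beta> x
    using D by (simp add: has_partials_def)
  have cD: "continuous_on UNIV (D \<beta>)" for \<beta>
    by (intro continuous_at_imp_continuous_on ballI has_derivative_continuous[OF dD])
  have ce: "continuous_on UNIV ?e" by (intro continuous_intros)
  have de: "(?e has_derivative (\<lambda>h. - 2 * pi * \<i> * cdot h \<zeta> * ?e x)) (at x)" for x
  proof -
    have "((\<lambda>x. - 2 * pi * \<i> * cdot x \<zeta>) has_derivative (\<lambda>h. - 2 * pi * \<i> * cdot h \<zeta>)) (at x)"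
      by (intro has_derivative_mult_right bounded_linear_imp_has_derivative bounded_linear_cdot)
    from has_derivative_compose[OF this DERIV_exp[unfolded has_field_derivative_def]]
    show ?thesis by (simp add: mult.commute mult.left_commute)
  qed
  define F' where "F' x h = D \<beta> x * (- 2 * pi * \<i> * cdot h \<zeta> * ?e x) +
      (\<Sum>j\<in>UNIV. (h $ j) *\<^sub>R D (\<beta>(j := Suc (\<beta> j))) x) * ?e x" for x h
  have F': "F' x (axis k 1) = - (2 * pi * \<i> * \<zeta> $ k) * (D \<beta> x * ?e x) + D ?\<beta> x * ?e x" for x
  proof -
    have ax: "axis k (1::real) $ j = (if j = k then 1 else 0)" for j by (simp add: axis_def)
    show ?thesis by (simp add: F'_def cdot_axis_left ax if_distribR if_distrib cong: if_cong)
  qed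
  have le: "norm (D \<beta> x * ?e x) \<le> K \<beta> * E * exp (b * norm (Im_vec \<zeta>) powr q) * exp (- norm x)" for \<beta> x
    by (rule fourier_laplace_integrand_le[OF young decay])
  have int: "integrable lborel (\<lambda>x. D \<beta> x * ?e x)" for \<beta>
  proof (rule Bochner_Integration.integrable_bound)
    show "integrable lborel (\<lambda>x::real^'d. K \<beta> * E * exp (b * norm (Im_vec \<zeta>) powr q) * exp (- norm x))"
      by (intro integrable_mult_right integrable_exp_neg_norm)
    show "(\<lambda>x. D \<beta> x * ?e x) \<in> borel_measurable lborel"
      using cD ce by (auto intro!: borel_measurable_continuous_onI continuous_on_mult)
  qed (use le in \<open>auto intro!: AE_I2 order_trans[OF _ abs_ge_self]\<close>)
  let ?z = "2 * pi * \<i> * \<zeta> $ k"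
  \<comment> \<open>A single constant that dominates both the product and its derivative in
    direction \<open>k\<close>, as \<open>integral_directional_derivative_eq_0\<close>
    requires.\<close>
  let ?L = "?M * (K \<beta> + norm ?z * K \<beta> + K ?\<beta>)"
  have E: "E \<ge> 0" using young[of 0 0] by simp
  have K: "K \<beta> \<ge> 0" for \<beta>
    using order_trans[OF norm_ge_zero decay[of \<beta> 0]] by (simp add: zero_le_mult_iff)
  have M: "?M \<ge> 0" using E by simp
  have le': "norm (D \<beta> x * ?e x) \<le> ?M * K \<beta> * exp (- norm x)" for \<beta> x
    using le[of \<beta> x] by (simp only: mult_ac)
  have "(LINT x|lborel. F' x (axis k 1)) = 0"
  proof (rule integral_directional_derivative_eq_0[where K = ?L and F = "\<lambda>x. D \<beta> x * ?e x"])
    show "((\<lambda>x. D \<beta> x * ?e x) has_derivative F' x) (at x)" for x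
      unfolding F'_def by (rule has_derivative_mult[OF dD de])
    show "norm (D \<beta> x * ?e x) \<le> ?L * exp (- norm x)" for x
    proof -
      have "?M * K \<beta> \<le> ?L" using M K by (intro mult_left_mono) auto
      thus ?thesis using le'[of \<beta> x] by (meson exp_ge_zero mult_right_mono order_trans)
    qed
    show "norm (F' x (axis k 1)) \<le> ?L * exp (- norm x)" for x
    proof -
      have "norm (F' x (axis k 1)) \<le> norm ?z * norm (D \<beta> x * ?e x) + norm (D ?\<beta> x * ?e x)"
        unfolding F' by (rule order_trans[OF norm_triangle_ineq]) (simp add: norm_mult)
      also have "\<dots> \<le> norm ?z * (?M * K \<beta> * exp (- norm x)) + ?M * K ?\<beta> * exp (- norm x)"
        by (intro add_mono mult_left_mono le') auto
      also have "\<dots> = ?M * (norm ?z * K \<beta> + K ?\<beta>) * exp (- norm x)"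
        by (simp add: algebra_simps)
      also have "\<dots> \<le> ?L * exp (- norm x)"
        using M K by (intro mult_right_mono mult_left_mono) auto
      finally show ?thesis .
    qed
    show "(\<lambda>x. F' x (axis k 1)) \<in> borel_measurable borel"
      unfolding F' using cD ce by (auto intro!: borel_measurable_continuous_onI continuous_intros)
  qed
  hence "- ?z * fourier_laplace (D \<beta>) \<zeta> + fourier_laplace (D ?\<beta>) \<zeta> = 0"
    unfolding F' fourier_laplace_def using int by simp
  thus ?thesis by (simp add: algebra_simps add_eq_0_iff)
qed

text \<open>The growth in the imaginary part is that of the kernel. For the decay, repeated partial
  derivatives in one direction \<open>k\<close> produce powers of \<open>\<zeta> $ k\<close>, and
  the factorial bounds on these derivatives become moment bounds for the transform.\<close>

lemma fourier_laplace_gelfand_shilov: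
  fixes g :: "real^'d::finite \<Rightarrow> complex"
  assumes r: "r > 1" and g: "g \<in> gelfand_shilov (1 / r)"
  obtains a b C where "a > 0" "b > 0" "C > 0"
    "\<And>\<zeta>. norm (fourier_laplace g \<zeta>) \<le>
       C * exp (b * norm (Im_vec \<zeta>) powr (r / (r - 1))) * exp (- a * norm (Re_vec \<zeta>) powr r)"
proof -
  obtain D a B c where D: "has_partials g D" and pos: "a > 0" "B > 0" "c > 0"
    and decay: "\<And>\<beta> x. norm (D \<beta> x) \<le> c * B ^ (\<Sum>j\<in>UNIV. \<beta> j) * multi_fact \<beta> powr (1 / r) * exp (- a * norm x powr r)"
    by (rule gelfand_shilov_decay[OF r g], (rule that; blast))
  obtain b E where bE: "b > 0" "E > 0" and young: "\<And>x y. x \<ge> 0 \<Longrightarrow> y \<ge> 0 \<Longrightarrow>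
       exp (- a * x powr r + 2 * pi * x * y) \<le> E * exp (b * y powr (r / (r - 1))) * exp (- x)"
    by (rule exp_young[OF r pos(1)], (rule that; blast))
  define I where "I = (LINT x|lborel. exp (- norm (x :: real^'d)))"
  have I: "I \<ge> 0" unfolding I_def by (rule Bochner_Integration.integral_nonneg) auto
  define \<alpha> where "\<alpha> k n = (\<lambda>i::'d. if i = k then n else 0 :: nat)" for k n
  have \<alpha>: "multi_fact (\<alpha> k n) = fact n" "(\<Sum>j\<in>UNIV. \<alpha> k n j) = n" for k n
    by (simp_all add: multi_fact_def \<alpha>_def if_distrib cong: if_cong)
  have pow: "fourier_laplace (D (\<alpha> k n)) \<zeta> = (2 * pi * \<i> * \<zeta> $ k) ^ n * fourier_laplace g \<zeta>" for k n \<zeta>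
  proof (induction n)
    case 0
    have "\<alpha> k 0 = (\<lambda>_. 0)" by (auto simp: \<alpha>_def)
    thus ?case using D by (simp add: has_partials_def)
  next
    case (Suc n)
    have "\<alpha> k (Suc n) = (\<alpha> k n)(k := Suc (\<alpha> k n k))" by (auto simp: \<alpha>_def)
    thus ?case using fourier_laplace_partial[OF D young decay, of "\<alpha> k n" k \<zeta>] Suc by simp
  qed
  \<comment> \<open>The rate given by \<open>exp_decay_of_moment_bounds\<close> for moments growing
    like \<open>(B / (2 * pi)) ^ n\<close>; each derivative contributes a factor
    \<open>2 * pi\<close> through \<open>pow\<close>.\<close>
  define a' where "a' = (1 / (B / (2 * pi))) powr r / (2 * r)"
  have a': "a' > 0" using pos r by (simp add: a'_def)
  show thesis
  \<comment> \<open>Only \<open>I \<ge> 0\<close> is at hand; the added \<open>1\<close> makes the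
    constant positive.\<close>
  proof (rule that[of "a' * (1 / real CARD('d)) powr r" b "2 * (c * E * I + 1)"])
    show "a' * (1 / real CARD('d)) powr r > 0" "b > 0" using a' bE by auto
    show "2 * (c * E * I + 1) > 0" using pos bE I by (smt (verit) mult_nonneg_nonneg)
    fix \<zeta> :: "complex^'d"
    let ?W = "exp (b * norm (Im_vec \<zeta>) powr (r / (r - 1)))"
    obtain k where k: "norm (Re_vec \<zeta>) \<le> real CARD('d) * \<bar>Re_vec \<zeta> $ k\<bar>" by (rule exists_large_component)
    have "norm (fourier_laplace g \<zeta>) \<le> 2 * (c * E * I * ?W) * exp (- ((1 / (B / (2 * pi))) powr r / (2 * r)) * norm (\<zeta> $ k) powr r)"
    proof (rule exp_decay_of_moment_bounds)
      fix n :: nat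
      have "norm (fourier_laplace (D (\<alpha> k n)) \<zeta>) \<le> c * B ^ n * fact n powr (1 / r) * E * ?W * I"
        using fourier_laplace_bound[OF young decay, of "\<alpha> k n" \<zeta>] unfolding \<alpha> I_def .
      hence "(2 * pi * norm (\<zeta> $ k)) ^ n * norm (fourier_laplace g \<zeta>) \<le> c * B ^ n * fact n powr (1 / r) * E * ?W * I"
        by (simp add: pow norm_mult norm_power)
      hence "(2 * pi * norm (\<zeta> $ k)) ^ n * norm (fourier_laplace g \<zeta>) / (2 * pi) ^ n \<le>
          c * B ^ n * fact n powr (1 / r) * E * ?W * I / (2 * pi) ^ n"
        by (intro divide_right_mono) auto
      thus "norm (\<zeta> $ k) ^ n * norm (fourier_laplace g \<zeta>) \<le> c * E * I * ?W * (B / (2 * pi)) ^ n * fact n powr (1 / r)"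
        unfolding power_mult_distrib power_divide by (simp add: mult_ac)
    qed (use pos r in auto)
    also have "\<dots> \<le> 2 * (c * E * I * ?W) * exp (- (a' * (1 / real CARD('d)) powr r) * norm (Re_vec \<zeta>) powr r)"
    proof -
      \<comment> \<open>The coordinate \<open>k\<close> maximises the real part, and
        \<open>norm (\<zeta> $ k)\<close>, in which the decay was obtained, is at least as large as
        that real part.\<close>
      have "norm (Re_vec \<zeta>) \<le> real CARD('d) * norm (\<zeta> $ k)"
        by (rule order_trans[OF k mult_left_mono]) (auto simp: Re_vec_def abs_Re_le_cmod)
      from exp_neg_powr_component_le[OF _ a' this, of r] r
      show ?thesis using pos bE I by (intro mult_left_mono) (auto simp: a'_def)
    qed
    also have "\<dots> \<le> 2 * (c * E * I + 1) * ?W * exp (- (a' * (1 / real CARD('d)) powr r) * norm (Re_vec \<zeta>) powr r)"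
      by (intro mult_right_mono) (simp_all add: algebra_simps)
    finally show "norm (fourier_laplace g \<zeta>) \<le> 2 * (c * E * I + 1) * ?W * exp (- (a' * (1 / real CARD('d)) powr r) * norm (Re_vec \<zeta>) powr r)" .
  qed
qed

lemma continuous_gelfand_shilov:
  assumes "g \<in> gelfand_shilov s"
  shows "continuous_on UNIV g"
proof -
  obtain D where D: "has_partials g D" using assms unfolding gelfand_shilov_def by blast
  hence "D (\<lambda>_. 0) = g" "(D (\<lambda>_. 0) has_derivative (\<lambda>h. \<Sum>j\<in>UNIV. (h $ j) *\<^sub>R D ((\<lambda>_. 0)(j := Suc 0)) x)) (at x)" for x
    unfolding has_partials_def by auto
  hence "(g has_derivative (\<lambda>h. \<Sum>j\<in>UNIV. (h $ j) *\<^sub>R D ((\<lambda>_. 0)(j := Suc 0)) x)) (at x)" for x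
    by simp
  thus ?thesis by (intro continuous_at_imp_continuous_on ballI has_derivative_continuous)
qed

lemma gelfand_shilov_norm_le:
  fixes g :: "real^'d::finite \<Rightarrow> complex"
  assumes r: "r > 1" and g: "g \<in> gelfand_shilov (1 / r)"
  obtains K a where "a > 0" "\<And>x. norm (g x) \<le> K * exp (- a * norm x powr r)"
proof -
  obtain D a B c where D: "has_partials g D" and pos: "a > 0" "B > 0" "c > 0"
    and decay: "\<And>\<beta> x. norm (D \<beta> x) \<le> c * B ^ (\<Sum>j\<in>UNIV. \<beta> j) * multi_fact \<beta> powr (1 / r) * exp (- a * norm x powr r)"
    by (rule gelfand_shilov_decay[OF r g], (rule that; blast))
  have "D (\<lambda>_. 0) = g" using D by (simp add: has_partials_def)
  with decay[of "\<lambda>_. 0"] show thesis by (intro that[OF pos(1)]) auto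
qed

lemma norm_Im_vec_axis:
  fixes \<xi> :: "real^'d::finite"
  shows "norm (Im_vec (cvec \<xi> + axis j s)) = \<bar>Im s\<bar>"
proof -
  have "Im_vec (cvec \<xi> + axis j s) = axis j (Im s)"
    by (auto simp: Im_vec_def cvec_def axis_def vec_eq_iff)
  thus ?thesis by (simp add: norm_eq_sqrt_inner inner_axis_axis)
qed

lemma Re_vec_axis:
  fixes \<xi> :: "real^'d::finite"
  shows "Re_vec (cvec \<xi> + axis j s) = \<xi> + axis j (Re s)"
  by (auto simp: Re_vec_def cvec_def axis_def vec_eq_iff)

lemma continuous_on_cvec [continuous_intros]: "continuous_on A f \<Longrightarrow> continuous_on A (\<lambda>x. cvec (f x))"
  unfolding cvec_def by (intro continuous_intros)

text \<open>For \<open>norm s \<le> R\<close> the imaginary part of the frequency has norm at most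
  \<open>R\<close>, so one multiple of \<open>exp (- norm x)\<close> dominates the integrand and
  \<open>holomorphic_integral\<close> applies.\<close>

lemma fourier_laplace_holomorphic:
  fixes g :: "real^'d::finite \<Rightarrow> complex"
  assumes r: "r > 1" and g: "g \<in> gelfand_shilov (1 / r)"
  shows "(\<lambda>s. fourier_laplace g (cvec \<xi> + axis j s)) holomorphic_on UNIV"
proof -
  obtain K a where a: "a > 0" and decay: "\<And>x. norm (g x) \<le> K * exp (- a * norm x powr r)"
    by (rule gelfand_shilov_norm_le[OF r g], (rule that; blast))
  obtain b E where bE: "b > 0" "E > 0" and young: "\<And>x y. x \<ge> 0 \<Longrightarrow> y \<ge> 0 \<Longrightarrow>
       exp (- a * x powr r + 2 * pi * x * y) \<le> E * exp (b * y powr (r / (r - 1))) * exp (- x)"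
    by (rule exp_young[OF r a], (rule that; blast))
  have K: "K \<ge> 0" using order_trans[OF norm_ge_zero decay[of 0]] by (simp add: zero_le_mult_iff)
  show ?thesis
    unfolding fourier_laplace_def
  proof (rule holomorphic_integral)
    show "(\<lambda>x. g x * exp (- 2 * pi * \<i> * cdot x (cvec \<xi> + axis j s))) \<in> borel_measurable lborel" for s
      using continuous_gelfand_shilov[OF g] by (auto intro!: borel_measurable_continuous_onI continuous_intros)
    show "(\<lambda>s. g x * exp (- 2 * pi * \<i> * cdot x (cvec \<xi> + axis j s))) holomorphic_on UNIV" for x
      unfolding cdot_add cdot_axis by (intro holomorphic_intros)
  next
    fix R :: real
    let ?h = "\<lambda>x::real^'d. K * E * exp (b * \<bar>R\<bar> powr (r / (r - 1))) * exp (- norm x)"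
    show "\<exists>h. integrable lborel h \<and> (\<forall>s x. norm s \<le> R \<longrightarrow> norm (g x * exp (- 2 * pi * \<i> * cdot x (cvec \<xi> + axis j s))) \<le> h x)"
    proof (intro exI[of _ ?h] conjI allI impI)
      show "integrable lborel ?h" by (intro integrable_mult_right integrable_exp_neg_norm)
      fix s :: complex and x :: "real^'d" assume s: "norm s \<le> R"
      have "\<bar>Im s\<bar> powr (r / (r - 1)) \<le> \<bar>R\<bar> powr (r / (r - 1))"
        using s abs_Im_le_cmod[of s] r by (intro powr_mono2) auto
      hence "K * E * exp (b * \<bar>Im s\<bar> powr (r / (r - 1))) * exp (- norm x) \<le> ?h x"
        using K bE by (intro mult_right_mono mult_left_mono) auto
      thus "norm (g x * exp (- 2 * pi * \<i> * cdot x (cvec \<xi> + axis j s))) \<le> ?h x"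
        using fourier_laplace_integrand_le[OF young decay, of x "cvec \<xi> + axis j s"]
        unfolding norm_Im_vec_axis by linarith
    qed
  qed
qed

lemma borel_measurable_fourier_laplace:
  assumes g: "continuous_on UNIV g"
  shows "fourier_laplace g \<in> borel_measurable borel"
  unfolding fourier_laplace_def[abs_def]
proof (rule sigma_finite_measure.borel_measurable_lebesgue_integral[OF sigma_finite_lborel])
  have "(\<lambda>(\<zeta>, x). g x * exp (- 2 * pi * \<i> * cdot x \<zeta>)) \<in> borel_measurable (borel \<Otimes>\<^sub>M borel)"
    unfolding borel_prod case_prod_beta
    by (intro borel_measurable_continuous_onI continuous_intros continuous_on_compose2[OF g]) auto
  thus "(\<lambda>(\<zeta>, x). g x * exp (- 2 * pi * \<i> * cdot x \<zeta>)) \<in> borel_measurable (borel \<Otimes>\<^sub>M lborel)"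
    unfolding measurable_cong_sets[OF sets_pair_measure_cong[OF refl sets_lborel] refl] .
qed

section \<open>The pairing\<close>

lemma integrable_of_exp_bound:
  fixes f :: "'a::euclidean_space \<Rightarrow> complex"
  assumes "f \<in> borel_measurable borel" "\<And>x. norm (f x) \<le> K * exp (- norm (x - c))"
  shows "integrable lborel f"
proof (rule Bochner_Integration.integrable_bound)
  show "integrable lborel (\<lambda>x. K * exp (- norm (x - c)))"
    using integrable_lborel_shift[OF integrable_exp_neg_norm, of "- c"] by simp
qed (use assms in \<open>auto intro!: AE_I2 order_trans[OF _ abs_ge_self]\<close>)

text \<open>Fubini takes the place of Plancherel's theorem: with both functions integrable, their
  product is integrable in \<open>(\<xi>, y)\<close>, and exchanging the integrals moves the
  exponential onto \<open>h\<close>.\<close>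

lemma L2_inner_fourier_multiplier:
  fixes f h :: "real^'d::finite \<Rightarrow> complex"
  assumes \<phi>: "integrable lborel (\<lambda>\<xi>. \<mu> \<xi> * fourier f \<xi>)" and h: "integrable lborel h"
  shows "L2_inner (fourier_multiplier \<mu> f) h = (LINT \<xi>|lborel. \<mu> \<xi> * fourier f \<xi> * cnj (fourier h \<xi>))"
proof -
  define \<phi> where "\<phi> \<xi> = \<mu> \<xi> * fourier f \<xi>" for \<xi>
  have i: "integrable lborel \<phi>" using \<phi> by (simp add: \<phi>_def[abs_def])
  have m\<phi> [measurable]: "\<phi> \<in> borel_measurable borel" using borel_measurable_integrable[OF i] by simp
  have mh [measurable]: "h \<in> borel_measurable borel" using borel_measurable_integrable[OF h] by simp
  define P where "P \<xi> y = \<phi> \<xi> * cis (2 * pi * (y \<bullet> \<xi>)) * cnj (h y)" for \<xi> y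
  have mcis: "(\<lambda>p::(real^'d) \<times> (real^'d). cis (2 * pi * (snd p \<bullet> fst p))) \<in> borel_measurable (borel \<Otimes>\<^sub>M borel)"
    unfolding borel_prod by (intro borel_measurable_continuous_onI continuous_intros)
  have mcnj: "(\<lambda>y. cnj (h y)) \<in> borel_measurable borel"
    by (rule measurable_compose[OF mh borel_measurable_continuous_onI[OF continuous_on_cnj[OF continuous_on_id]]])
  have "(\<lambda>p. \<phi> (fst p) * cis (2 * pi * (snd p \<bullet> fst p)) * cnj (h (snd p))) \<in> borel_measurable (borel \<Otimes>\<^sub>M borel)"
    by (intro borel_measurable_times mcis measurable_compose[OF measurable_fst m\<phi>] measurable_compose[OF measurable_snd mcnj])
  hence mP: "case_prod P \<in> borel_measurable (lborel \<Otimes>\<^sub>M lborel)"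
    unfolding P_def case_prod_beta
    unfolding measurable_cong_sets[OF sets_pair_measure_cong[OF sets_lborel sets_lborel] refl] .
  have nP: "norm (P \<xi> y) = norm (\<phi> \<xi>) * norm (h y)" for \<xi> y
    by (simp add: P_def norm_mult)
  have iP: "integrable (lborel \<Otimes>\<^sub>M lborel) (case_prod P)"
  proof (rule lborel_pair.Fubini_integrable[OF mP])
    show "integrable lborel (\<lambda>\<xi>. LINT y|lborel. norm (case_prod P (\<xi>, y)))"
      using i by (simp add: nP)
    have "integrable lborel (\<lambda>y. P \<xi> y)" for \<xi>
    proof (rule Bochner_Integration.integrable_bound)
      show "integrable lborel (\<lambda>y. norm (\<phi> \<xi>) * norm (h y))" using h by simp
      show "(\<lambda>y. P \<xi> y) \<in> borel_measurable lborel"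
        using measurable_compose[OF measurable_Pair1' mP, of \<xi>] by simp
    qed (simp add: nP)
    thus "AE \<xi> in lborel. integrable lborel (\<lambda>y. case_prod P (\<xi>, y))" by simp
  qed
  have "L2_inner (fourier_multiplier \<mu> f) h = (LINT y|lborel. LINT \<xi>|lborel. P \<xi> y)"
    unfolding L2_inner_def fourier_multiplier_def inv_fourier_def P_def \<phi>_def
    by (simp only: integral_mult_left_zero)
  also have "\<dots> = (LINT \<xi>|lborel. LINT y|lborel. P \<xi> y)"
    by (rule lborel_pair.Fubini_integral[OF iP])
  also have "\<dots> = (LINT \<xi>|lborel. \<phi> \<xi> * cnj (fourier h \<xi>))"
  proof (rule Bochner_Integration.integral_cong[OF refl])
    fix \<xi>
    have "cnj (fourier h \<xi>) = (LINT y|lborel. cnj (h y * cis (- 2 * pi * (y \<bullet> \<xi>))))"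
      unfolding fourier_def by (rule Bochner_Integration.integral_cnj[symmetric])
    also have "\<dots> = (LINT y|lborel. cis (2 * pi * (y \<bullet> \<xi>)) * cnj (h y))"
      by (simp add: cis_cnj mult.commute)
    finally show "(LINT y|lborel. P \<xi> y) = \<phi> \<xi> * cnj (fourier h \<xi>)"
      unfolding P_def by (simp only: mult.assoc integral_mult_right_zero)
  qed
  finally show ?thesis unfolding \<phi>_def .
qed

lemma fourier_tf_shift:
  fixes g :: "real^'d::finite \<Rightarrow> complex"
  assumes g: "g \<in> borel_measurable borel"
  shows "fourier (tf_shift z g) \<xi> = cis (- 2 * pi * (fst z \<bullet> (\<xi> - snd z))) * fourier g (\<xi> - snd z)"
proof -
  let ?f = "\<lambda>x. tf_shift z g x * cis (- 2 * pi * (x \<bullet> \<xi>))"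
  have "?f \<in> borel_measurable borel"
    unfolding tf_shift_def
    by (intro borel_measurable_times measurable_compose[OF _ g])
      (auto intro!: borel_measurable_continuous_onI continuous_intros)
  hence "fourier (tf_shift z g) \<xi> = (LINT x|lborel. ?f (x + fst z))"
    unfolding fourier_def by (rule lborel_integral_shift[symmetric])
  also have "\<dots> = (LINT x|lborel. cis (- 2 * pi * (fst z \<bullet> (\<xi> - snd z))) * (g x * cis (- 2 * pi * (x \<bullet> (\<xi> - snd z)))))"
    by (intro Bochner_Integration.integral_cong)
      (auto simp: tf_shift_def cis_mult inner_simps inner_commute algebra_simps)
  also have "\<dots> = cis (- 2 * pi * (fst z \<bullet> (\<xi> - snd z))) * fourier g (\<xi> - snd z)"
    unfolding fourier_def by (rule integral_mult_right_zero)
  finally show ?thesis .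
qed

text \<open>For real \<open>s\<close> the hypothesis \<open>transl\<close> turns the shift into a
  translation of \<open>\<xi>\<close>, which preserves the integral. The reals accumulate at
  \<open>0\<close>, so the identity theorem extends the equality to all \<open>s\<close>.\<close>

lemma contour_shift:
  fixes G :: "real^'d::finite \<Rightarrow> complex \<Rightarrow> complex"
  assumes meas: "\<And>s. (\<lambda>\<xi>. G \<xi> s) \<in> borel_measurable borel"
    and hol: "\<And>\<xi>. G \<xi> holomorphic_on UNIV"
    and dom: "\<And>R. \<exists>h. integrable lborel h \<and> (\<forall>s \<xi>. norm s \<le> R \<longrightarrow> norm (G \<xi> s) \<le> h \<xi>)"
    and transl: "\<And>\<xi> u. G \<xi> (of_real u) = G (\<xi> + axis j u) 0"
  shows "(LINT \<xi>|lborel. G \<xi> s) = (LINT \<xi>|lborel. G \<xi> 0)"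
proof -
  have "(\<lambda>s. LINT \<xi>|lborel. G \<xi> s) holomorphic_on UNIV"
    by (rule holomorphic_integral) (use meas hol dom in auto)
  hence hol': "(\<lambda>s. (LINT \<xi>|lborel. G \<xi> s) - (LINT \<xi>|lborel. G \<xi> 0)) holomorphic_on UNIV"
    by (intro holomorphic_intros)
  have "(LINT \<xi>|lborel. G \<xi> s) - (LINT \<xi>|lborel. G \<xi> 0) = 0"
  proof (rule analytic_continuation[OF hol', of \<real> 0])
    show "0 islimpt (\<real> :: complex set)"
      unfolding islimpt_approachable
    proof (intro allI impI)
      fix e :: real assume "e > 0"
      thus "\<exists>x'\<in>\<real>. x' \<noteq> (0::complex) \<and> dist x' 0 < e"
        by (intro bexI[of _ "of_real (e / 2)"]) auto
    qed
    fix z :: complex assume "z \<in> \<real>"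
    then obtain u where u: "z = of_real u" by (auto elim: Reals_cases)
    show "(LINT \<xi>|lborel. G \<xi> z) - (LINT \<xi>|lborel. G \<xi> 0) = 0"
      unfolding u transl by (simp add: lborel_integral_shift[OF meas])
  qed auto
  thus ?thesis by simp
qed

lemma axis_zero: "axis j 0 = 0"
  by (simp add: axis_def vec_eq_iff)

lemma cvec_add_axis: "cvec (\<xi> + axis j u) = cvec \<xi> + axis j (of_real u)"
  by (auto simp: cvec_def axis_def vec_eq_iff)

text \<open>\<open>pairing_integrand m a t g z w j \<xi> s\<close> is, up to a unimodular factor, the extension of the integrand
  of \<open>L2_inner (propagator m a t (tf_shift z g)) (tf_shift w g)\<close> on the Fourier side to
  \<open>\<xi> + s e\<^sub>j\<close>.\<close>

definition pairing_integrand ::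
  "nat \<Rightarrow> (nat \<Rightarrow> 'd mpoly) \<Rightarrow> real \<Rightarrow> (real^'d \<Rightarrow> complex) \<Rightarrow> (real^'d) \<times> (real^'d) \<Rightarrow> (real^'d) \<times> (real^'d)
    \<Rightarrow> 'd::finite \<Rightarrow> real^'d \<Rightarrow> complex \<Rightarrow> complex" where
  "pairing_integrand m a t g z w j \<xi> s =
     ext_symbol m a t (cvec \<xi> + axis j s) *
     exp (2 * pi * \<i> * cdot (fst w - fst z) (cvec \<xi> + axis j s)) *
     fourier_laplace g (cvec (\<xi> - snd z) + axis j s) *
     cnj (fourier_laplace g (cvec (\<xi> - snd w) + axis j (cnj s)))"

section \<open>Estimates at a fixed time\<close>

context
  fixes m :: nat and a :: "nat \<Rightarrow> ('d::finite) mpoly" and t r A B \<nu> b c C :: real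
    and g :: "real^'d \<Rightarrow> complex"
  assumes m: "m \<ge> 1" and t: "t \<ge> 0" and r: "r > 1" and g: "g \<in> gelfand_shilov (1 / r)"
    and A: "A \<ge> 0" and B: "B \<ge> 0" and \<nu>: "\<nu> \<ge> 1"
    and symbol: "\<And>\<zeta>. norm (ext_symbol m a t \<zeta>) \<le> A * exp (B * (1 + norm (Im_vec \<zeta>)) powr \<nu>)"
    and b: "b > 0" and c: "c > 0" and C: "C > 0"
    and FL: "\<And>\<zeta>. norm (fourier_laplace g \<zeta>) \<le>
       C * exp (b * norm (Im_vec \<zeta>) powr (r / (r - 1))) * exp (- c * norm (Re_vec \<zeta>) powr r)"
begin

lemma borel_measurable_fourier_laplace_shift:
  "(\<lambda>\<xi>. fourier_laplace g (cvec (\<xi> - \<eta>) + axis j s)) \<in> borel_measurable borel"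
  by (rule measurable_compose[OF _ borel_measurable_fourier_laplace[OF continuous_gelfand_shilov[OF g]]])
    (intro borel_measurable_continuous_onI continuous_intros)

lemma borel_measurable_ext_symbol_shift:
  "(\<lambda>\<xi>. ext_symbol m a t (cvec \<xi> + axis j s)) \<in> borel_measurable borel"
  by (rule measurable_compose[OF _ borel_measurable_ext_symbol])
    (intro borel_measurable_continuous_onI continuous_intros)

lemma fourier_laplace_shift_le:
  "norm (fourier_laplace g (cvec (\<xi> - \<eta>) + axis j s)) \<le>
    C * exp (b * \<bar>Im s\<bar> powr (r / (r - 1))) * exp (- c * norm (\<xi> - \<eta> + axis j (Re s)) powr r)"
  using FL[of "cvec (\<xi> - \<eta>) + axis j s"] by (simp only: norm_Im_vec_axis Re_vec_axis)

text \<open>At \<open>s = 0\<close> the direction \<open>j\<close> drops out, so it can later be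
  chosen depending on \<open>z\<close> and \<open>w\<close>.\<close>

lemma norm_L2_inner_propagator:
  "norm (L2_inner (propagator m a t (tf_shift z g)) (tf_shift w g)) =
   norm (LINT \<xi>|lborel. pairing_integrand m a t g z w j \<xi> 0)"
proof -
  have cg: "continuous_on UNIV g" by (rule continuous_gelfand_shilov[OF g])
  have mg: "g \<in> borel_measurable borel" by (rule borel_measurable_continuous_onI[OF cg])
  note F = fourier_tf_shift[OF mg]
  obtain b' E where "b' > 0" and E: "E > 0" "\<And>x y. x \<ge> 0 \<Longrightarrow> y \<ge> 0 \<Longrightarrow>
       exp (- c * x powr r + 2 * pi * x * y) \<le> E * exp (b' * y powr (r / (r - 1))) * exp (- x)"
    by (rule exp_young[OF r c], (rule that; blast))
  \<comment> \<open>Young's estimate at \<open>y = 0\<close> reduces decay of order \<open>r\<close>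
    to plain exponential decay, which is integrable.\<close>
  have E': "exp (- c * x powr r) \<le> E * exp (- x)" if "x \<ge> 0" for x
    using E(2)[of x 0] that by simp
  have psym: "propagator_symbol m a t \<xi> = ext_symbol m a t (cvec \<xi> + axis j 0)" for \<xi>
    by (simp add: propagator_symbol_eq[OF m t] axis_zero)
  have i1: "integrable lborel (\<lambda>\<xi>. propagator_symbol m a t \<xi> * fourier (tf_shift z g) \<xi>)"
  proof (rule integrable_of_exp_bound)
    have "(\<lambda>\<xi>. cis (- 2 * pi * (fst z \<bullet> (\<xi> - snd z))) * fourier g (\<xi> - snd z)) \<in> borel_measurable borel"
    proof (intro borel_measurable_times)
      show "(\<lambda>\<xi>. cis (- 2 * pi * (fst z \<bullet> (\<xi> - snd z)))) \<in> borel_measurable borel"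
        by (intro borel_measurable_continuous_onI continuous_intros)
      show "(\<lambda>\<xi>. fourier g (\<xi> - snd z)) \<in> borel_measurable borel"
        using borel_measurable_fourier_laplace_shift[of "snd z" j 0]
        by (simp add: fourier_eq_fourier_laplace axis_zero)
    qed
    thus "(\<lambda>\<xi>. propagator_symbol m a t \<xi> * fourier (tf_shift z g) \<xi>) \<in> borel_measurable borel"
      unfolding F psym by (intro borel_measurable_times[OF borel_measurable_ext_symbol_shift])
    fix \<xi>
    have "norm (propagator_symbol m a t \<xi>) \<le> A * exp B"
      using symbol[of "cvec \<xi> + axis j 0"] unfolding psym norm_Im_vec_axis by simp
    moreover have "norm (fourier (tf_shift z g) \<xi>) \<le> C * E * exp (- norm (\<xi> - snd z))"
    proof -
      have "norm (fourier (tf_shift z g) \<xi>) \<le> C * exp (- c * norm (\<xi> - snd z) powr r)"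
        using fourier_laplace_shift_le[of \<xi> "snd z" j 0] b
        unfolding F norm_mult by (simp add: fourier_eq_fourier_laplace axis_zero)
      also have "\<dots> \<le> C * (E * exp (- norm (\<xi> - snd z)))"
        using C by (intro mult_left_mono E') auto
      finally show ?thesis by simp
    qed
    ultimately have "norm (propagator_symbol m a t \<xi>) * norm (fourier (tf_shift z g) \<xi>) \<le> (A * exp B) * (C * E * exp (- norm (\<xi> - snd z)))"
      using A by (intro mult_mono) auto
    thus "norm (propagator_symbol m a t \<xi> * fourier (tf_shift z g) \<xi>) \<le> (A * exp B * C * E) * exp (- norm (\<xi> - snd z))"
      by (simp add: norm_mult mult_ac)
  qed
  obtain K k where k: "k > 0" and decay: "\<And>x. norm (g x) \<le> K * exp (- k * norm x powr r)"
    by (rule gelfand_shilov_norm_le[OF r g], (rule that; blast))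
  obtain b'' E2 where "b'' > 0" and E2: "E2 > 0" "\<And>x y. x \<ge> 0 \<Longrightarrow> y \<ge> 0 \<Longrightarrow>
       exp (- k * x powr r + 2 * pi * x * y) \<le> E2 * exp (b'' * y powr (r / (r - 1))) * exp (- x)"
    by (rule exp_young[OF r k], (rule that; blast))
  have K: "K \<ge> 0" using order_trans[OF norm_ge_zero decay[of 0]] by (simp add: zero_le_mult_iff)
  have i2: "integrable lborel (tf_shift w g)"
  proof (rule integrable_of_exp_bound)
    show "tf_shift w g \<in> borel_measurable borel"
      unfolding tf_shift_def[abs_def]
      by (intro borel_measurable_continuous_onI continuous_intros continuous_on_compose2[OF cg]) auto
    fix x
    have "norm (tf_shift w g x) \<le> K * exp (- k * norm (x - fst w) powr r)"
      using decay[of "x - fst w"] by (simp add: tf_shift_def norm_mult)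
    also have "\<dots> \<le> K * (E2 * exp (- norm (x - fst w)))"
      using K E2(2)[of "norm (x - fst w)" 0] by (intro mult_left_mono) auto
    finally show "norm (tf_shift w g x) \<le> (K * E2) * exp (- norm (x - fst w))" by simp
  qed
  \<comment> \<open>The part of the phases of the two shifts that is independent of
    \<open>\<xi>\<close>; the remaining phase is the exponential in
    \<open>pairing_integrand\<close>.\<close>
  let ?c = "cis (2 * pi * (fst z \<bullet> snd z - fst w \<bullet> snd w))"
  have "L2_inner (propagator m a t (tf_shift z g)) (tf_shift w g) =
      (LINT \<xi>|lborel. propagator_symbol m a t \<xi> * fourier (tf_shift z g) \<xi> * cnj (fourier (tf_shift w g) \<xi>))"
    unfolding propagator_def by (rule L2_inner_fourier_multiplier[OF i1 i2])
  also have "\<dots> = (LINT \<xi>|lborel. ?c * pairing_integrand m a t g z w j \<xi> 0)"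
  proof (rule Bochner_Integration.integral_cong[OF refl])
    fix \<xi>
    let ?p = "\<lambda>v. cis (- 2 * pi * (fst v \<bullet> (\<xi> - snd v)))" and ?F = "\<lambda>v. fourier_laplace g (cvec (\<xi> - snd v))"
    have 1: "?p z * cnj (?p w) = ?c * cis (2 * pi * ((fst w - fst z) \<bullet> \<xi>))"
      unfolding cis_cnj cis_mult by (rule arg_cong[where f = cis]) (simp add: inner_simps algebra_simps)
    have 2: "exp (2 * pi * \<i> * cdot (fst w - fst z) (cvec \<xi>)) = cis (2 * pi * ((fst w - fst z) \<bullet> \<xi>))"
      by (simp add: cdot_cvec cis_conv_exp mult_ac)
    have "propagator_symbol m a t \<xi> * fourier (tf_shift z g) \<xi> * cnj (fourier (tf_shift w g) \<xi>) =
        ext_symbol m a t (cvec \<xi>) * (?p z * ?F z) * cnj (?p w * ?F w)"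
      unfolding F psym axis_zero add_0_right by (simp only: fourier_eq_fourier_laplace)
    also have "\<dots> = ext_symbol m a t (cvec \<xi>) * (?p z * cnj (?p w)) * ?F z * cnj (?F w)"
      by (simp only: complex_cnj_mult mult_ac)
    also have "\<dots> = ?c * pairing_integrand m a t g z w j \<xi> 0"
      unfolding 1 pairing_integrand_def complex_cnj_zero axis_zero add_0_right 2 by (simp only: mult_ac)
    finally show "propagator_symbol m a t \<xi> * fourier (tf_shift z g) \<xi> * cnj (fourier (tf_shift w g) \<xi>) =
        ?c * pairing_integrand m a t g z w j \<xi> 0" .
  qed
  also have "\<dots> = ?c * (LINT \<xi>|lborel. pairing_integrand m a t g z w j \<xi> 0)"
    by (rule integral_mult_right_zero)
  finally show ?thesis by (simp add: norm_mult)
qed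

text \<open>Conjugating \<open>s\<close> in the last transform changes neither \<open>Re s\<close>
  nor \<open>\<bar>Im s\<bar>\<close>, so the two transforms contribute alike, whence
  \<open>C\<^sup>2\<close> and \<open>2 * b\<close>. The factor with
  \<open>(fst w - fst z) $ j\<close> is the one that can be made small by the sign of
  \<open>Im s\<close>.\<close>

lemma norm_pairing_integrand_le:
  "norm (pairing_integrand m a t g z w j \<xi> s) \<le>
     A * exp (B * (1 + \<bar>Im s\<bar>) powr \<nu>) *
     exp (- 2 * pi * ((fst w - fst z) $ j) * Im s) * C\<^sup>2 * exp (2 * b * \<bar>Im s\<bar> powr (r / (r - 1))) *
     (exp (- c * norm (\<xi> - snd z + axis j (Re s)) powr r) * exp (- c * norm (\<xi> - snd w + axis j (Re s)) powr r))"
proof -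
  let ?q = "exp (b * \<bar>Im s\<bar> powr (r / (r - 1)))"
  have 1: "norm (ext_symbol m a t (cvec \<xi> + axis j s)) \<le> A * exp (B * (1 + \<bar>Im s\<bar>) powr \<nu>)"
    using symbol[of "cvec \<xi> + axis j s"] unfolding norm_Im_vec_axis .
  have 2: "norm (exp (2 * pi * \<i> * cdot (fst w - fst z) (cvec \<xi> + axis j s))) = exp (- 2 * pi * ((fst w - fst z) $ j) * Im s)"
    by (simp add: cdot_add cdot_axis cdot_cvec algebra_simps)
  have 3: "norm (fourier_laplace g (cvec (\<xi> - snd z) + axis j s)) \<le> C * ?q * exp (- c * norm (\<xi> - snd z + axis j (Re s)) powr r)"
    by (rule fourier_laplace_shift_le)
  have 4: "norm (cnj (fourier_laplace g (cvec (\<xi> - snd w) + axis j (cnj s)))) \<le> C * ?q * exp (- c * norm (\<xi> - snd w + axis j (Re s)) powr r)"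
    using fourier_laplace_shift_le[of \<xi> "snd w" j "cnj s"] by simp
  have "norm (pairing_integrand m a t g z w j \<xi> s) \<le> A * exp (B * (1 + \<bar>Im s\<bar>) powr \<nu>) *
     exp (- 2 * pi * ((fst w - fst z) $ j) * Im s) * (C * ?q * exp (- c * norm (\<xi> - snd z + axis j (Re s)) powr r)) *
     (C * ?q * exp (- c * norm (\<xi> - snd w + axis j (Re s)) powr r))"
    unfolding pairing_integrand_def norm_mult[of "_ * _"] norm_mult[of "ext_symbol m a t _"] 2
    using A C by (intro mult_mono 1 3 4) auto
  moreover have Q: "exp (2 * b * \<bar>Im s\<bar> powr (r / (r - 1))) = ?q * ?q"
    by (simp flip: exp_add)
  ultimately show ?thesis unfolding Q power2_eq_square by (simp only: mult_ac)
qed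

text \<open>An instance of \<open>contour_shift\<close>. On bounded sets of \<open>s\<close> the
  growth in \<open>Im s\<close> is bounded, and the translation by \<open>Re s\<close> is absorbed
  in the factor \<open>exp \<bar>R\<bar>\<close>.\<close>

lemma integral_pairing_integrand_shift:
  "(LINT \<xi>|lborel. pairing_integrand m a t g z w j \<xi> 0) = (LINT \<xi>|lborel. pairing_integrand m a t g z w j \<xi> s)"
proof (rule contour_shift[symmetric, where j = j])
  let ?G = "pairing_integrand m a t g z w j"
  show "(\<lambda>\<xi>. ?G \<xi> s) \<in> borel_measurable borel" for s
    unfolding pairing_integrand_def
  proof (intro borel_measurable_times borel_measurable_fourier_laplace_shift borel_measurable_ext_symbol_shift)
    show "(\<lambda>\<xi>. exp (2 * pi * \<i> * cdot (fst w - fst z) (cvec \<xi> + axis j s))) \<in> borel_measurable borel"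
      by (intro borel_measurable_continuous_onI continuous_intros)
    show "(\<lambda>\<xi>. cnj (fourier_laplace g (cvec (\<xi> - snd w) + axis j (cnj s)))) \<in> borel_measurable borel"
      by (rule measurable_compose[OF borel_measurable_fourier_laplace_shift
            borel_measurable_continuous_onI[OF continuous_on_cnj[OF continuous_on_id]]])
  qed
  show "?G \<xi> holomorphic_on UNIV" for \<xi>
  proof -
    have "(\<lambda>s. ext_symbol m a t (cvec \<xi> + axis j s)) holomorphic_on UNIV"
    proof (rule holomorphic_ext_symbol)
      show "(\<lambda>s. (cvec \<xi> + axis j s) $ i) holomorphic_on UNIV" for i
        by (cases "i = j") (auto simp: axis_def intro!: holomorphic_intros)
    qed
    moreover have "(\<lambda>s. exp (2 * pi * \<i> * cdot (fst w - fst z) (cvec \<xi> + axis j s))) holomorphic_on UNIV"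
      unfolding cdot_add cdot_axis by (intro holomorphic_intros)
    \<comment> \<open>Conjugating both the argument and the value restores holomorphy; this is the
      reason for \<open>cnj s\<close> in \<open>pairing_integrand\<close>.\<close>
    moreover have "(cnj \<circ> (\<lambda>s. fourier_laplace g (cvec (\<xi> - snd w) + axis j s)) \<circ> cnj) holomorphic_on UNIV"
      by (rule holomorphic_on_compose_cnj_cnj)
        (auto intro: holomorphic_on_subset[OF fourier_laplace_holomorphic[OF r g]])
    hence "(\<lambda>s. cnj (fourier_laplace g (cvec (\<xi> - snd w) + axis j (cnj s)))) holomorphic_on UNIV"
      by (simp add: o_def)
    ultimately show ?thesis
      unfolding pairing_integrand_def[abs_def]
      by (intro holomorphic_on_mult fourier_laplace_holomorphic[OF r g])
  qed
  show "?G \<xi> (of_real u) = ?G (\<xi> + axis j u) 0" for \<xi> u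
  proof -
      have "cvec (\<xi> - \<eta>) + axis j (of_real u) = cvec (\<xi> + axis j u - \<eta>)" for \<eta>
      unfolding cvec_add_axis[symmetric] by (simp add: algebra_simps)
    thus ?thesis
      by (simp add: pairing_integrand_def axis_zero cvec_add_axis)
  qed
  fix R :: real
  obtain b' E where "b' > 0" and E: "E > 0" "\<And>x y. x \<ge> 0 \<Longrightarrow> y \<ge> 0 \<Longrightarrow>
       exp (- c * x powr r + 2 * pi * x * y) \<le> E * exp (b' * y powr (r / (r - 1))) * exp (- x)"
    by (rule exp_young[OF r c], (rule that; blast))
  let ?y = "(fst w - fst z) $ j"
  let ?K = "A * exp (B * (1 + \<bar>R\<bar>) powr \<nu>) * exp (2 * pi * \<bar>?y\<bar> * \<bar>R\<bar>) * C\<^sup>2 * exp (2 * b * \<bar>R\<bar> powr (r / (r - 1)))"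
  let ?h = "\<lambda>\<xi>. ?K * (E * exp \<bar>R\<bar> * exp (- norm (\<xi> - snd z)))"
  show "\<exists>h. integrable lborel h \<and> (\<forall>s \<xi>. norm s \<le> R \<longrightarrow> norm (?G \<xi> s) \<le> h \<xi>)"
  proof (intro exI[of _ ?h] conjI allI impI)
    show "integrable lborel ?h"
      using integrable_lborel_shift[OF integrable_exp_neg_norm, of "- snd z"]
      by (intro integrable_mult_right) simp
    fix s :: complex and \<xi> :: "real^'d" assume s: "norm s \<le> R"
    have I: "\<bar>Im s\<bar> \<le> \<bar>R\<bar>" and Re: "\<bar>Re s\<bar> \<le> \<bar>R\<bar>"
      using s abs_Im_le_cmod[of s] abs_Re_le_cmod[of s] by auto
    have "- ?y * Im s \<le> \<bar>?y\<bar> * \<bar>Im s\<bar>" by (metis abs_ge_self abs_minus_cancel abs_mult)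
    also have "\<dots> \<le> \<bar>?y\<bar> * \<bar>R\<bar>" using I by (intro mult_left_mono) auto
    finally have "2 * pi * (- ?y * Im s) \<le> 2 * pi * (\<bar>?y\<bar> * \<bar>R\<bar>)" by (intro mult_left_mono) auto
    hence 1: "exp (- 2 * pi * ?y * Im s) \<le> exp (2 * pi * \<bar>?y\<bar> * \<bar>R\<bar>)"
      by (simp only: exp_le_cancel_iff mult_minus_left mult_minus_right mult.assoc)
    have 2: "exp (B * (1 + \<bar>Im s\<bar>) powr \<nu>) \<le> exp (B * (1 + \<bar>R\<bar>) powr \<nu>)"
      using I B \<nu> by (auto intro!: mult_left_mono powr_mono2)
    have 3: "exp (2 * b * \<bar>Im s\<bar> powr (r / (r - 1))) \<le> exp (2 * b * \<bar>R\<bar> powr (r / (r - 1)))"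
      using I b r by (auto intro!: mult_left_mono powr_mono2)
    let ?u = "norm (\<xi> - snd z + axis j (Re s))" and ?v = "norm (\<xi> - snd w + axis j (Re s))"
    have "norm (\<xi> - snd z) \<le> ?u + norm (axis j (Re s))"
      using norm_triangle_ineq4[of "\<xi> - snd z + axis j (Re s)" "axis j (Re s)"] by simp
    also have "norm (axis j (Re s)) = \<bar>Re s\<bar>" by (simp add: norm_eq_sqrt_inner inner_axis_axis)
    finally have "exp (- ?u) \<le> exp \<bar>R\<bar> * exp (- norm (\<xi> - snd z))"
      using Re by (simp flip: exp_add)
    hence "E * exp (- ?u) \<le> E * (exp \<bar>R\<bar> * exp (- norm (\<xi> - snd z)))" using E(1) by (intro mult_left_mono) auto
    moreover have "exp (- c * ?u powr r) \<le> E * exp (- ?u)"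
      using E(2)[of ?u 0] by simp
    ultimately have "exp (- c * ?u powr r) \<le> E * exp \<bar>R\<bar> * exp (- norm (\<xi> - snd z))" by simp
    \<comment> \<open>The decay of the first transform already gives integrability, so the second
      one is estimated by \<open>1\<close>.\<close>
    moreover have "exp (- c * ?v powr r) \<le> 1" using c by simp
    ultimately have 4: "exp (- c * ?u powr r) * exp (- c * ?v powr r) \<le> (E * exp \<bar>R\<bar> * exp (- norm (\<xi> - snd z))) * 1"
      using E(1) by (intro mult_mono) auto
    have "A * exp (B * (1 + \<bar>Im s\<bar>) powr \<nu>) * exp (- 2 * pi * ?y * Im s) * C\<^sup>2 * exp (2 * b * \<bar>Im s\<bar> powr (r / (r - 1))) *
        (exp (- c * ?u powr r) * exp (- c * ?v powr r)) \<le> ?K * ((E * exp \<bar>R\<bar> * exp (- norm (\<xi> - snd z))) * 1)"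
      using A by (intro mult_mono 1 2 3 4) auto
    with norm_pairing_integrand_le[of z w j \<xi> s]
    show "norm (?G \<xi> s) \<le> ?h \<xi>" by simp
  qed
qed

text \<open>Integration over \<open>\<xi> + \<i> \<theta> sgn y\<^sub>j e\<^sub>j\<close>, where \<open>y = fst w - fst z\<close>.\<close>

lemma norm_L2_inner_propagator_le:
  assumes \<theta>: "\<theta> \<ge> 0"
    and E: "\<And>x. x \<ge> 0 \<Longrightarrow> exp (- (c / 2) * x powr r) \<le> E * exp (- x)"
  shows "norm (L2_inner (propagator m a t (tf_shift z g)) (tf_shift w g)) \<le>
    A * C\<^sup>2 * E * (LINT x|lborel. exp (- norm (x :: real^'d))) *
    exp (B * (1 + \<theta>) powr \<nu> + 2 * b * \<theta> powr (r / (r - 1)) - 2 * pi * \<bar>(fst w - fst z) $ j\<bar> * \<theta>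
      - c / 2 * (norm (snd w - snd z) / 2) powr r)"
proof -
  let ?y = "(fst w - fst z) $ j"
  define s where "s = \<i> * of_real (sgn ?y * \<theta>)"
  have s: "Re s = 0" "Im s = sgn ?y * \<theta>" by (simp_all add: s_def)
  have y: "?y * Im s = \<bar>?y\<bar> * \<theta>" using abs_sgn[of ?y] unfolding s mult.assoc[symmetric] by (rule arg_cong[OF sym, of _ _ "\<lambda>x. x * \<theta>"])
  let ?X = "exp (B * (1 + \<theta>) powr \<nu>)" and ?Q = "exp (2 * b * \<theta> powr (r / (r - 1)))"
    and ?Y = "exp (- 2 * pi * \<bar>?y\<bar> * \<theta>)" and ?H = "exp (- (c / 2) * (norm (snd w - snd z) / 2) powr r)"
  have E0: "E \<ge> 0" using E[of 0] by simp
  have le: "norm (pairing_integrand m a t g z w j \<xi> s) \<le> A * ?X * ?Y * C\<^sup>2 * ?Q * (?H * E) * exp (- norm (\<xi> - snd z))" for \<xi>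
  proof -
    let ?u = "norm (\<xi> - snd z)" and ?v = "norm (\<xi> - snd w)"
    \<comment> \<open>One of \<open>?u\<close> and \<open>?v\<close> is at least half the distance
      of the frequencies. Half of the rate \<open>c\<close> pays for decay in this distance, and the
      other half, kept on \<open>?u\<close>, makes the integral over \<open>\<xi>\<close>
      converge.\<close>
    have "norm (snd w - snd z) \<le> ?u + ?v"
      using norm_triangle_ineq4[of "\<xi> - snd z" "\<xi> - snd w"] by simp
    hence "norm (snd w - snd z) / 2 \<le> max ?u ?v" by simp
    hence "(norm (snd w - snd z) / 2) powr r \<le> (max ?u ?v) powr r"
      using r by (intro powr_mono2) auto
    also have "\<dots> \<le> ?u powr r + ?v powr r" by (simp add: max_def)
    finally have "c / 2 * (norm (snd w - snd z) / 2) powr r \<le> c / 2 * (?u powr r + ?v powr r)"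
      using c by (intro mult_left_mono) auto
    moreover have "0 \<le> c / 2 * ?v powr r" using c by simp
    ultimately have "exp (- c * ?u powr r + - c * ?v powr r) \<le> exp (- (c / 2) * (norm (snd w - snd z) / 2) powr r + - (c / 2) * ?u powr r)"
      unfolding exp_le_cancel_iff by (simp add: algebra_simps)
    hence "exp (- c * ?u powr r) * exp (- c * ?v powr r) \<le> ?H * exp (- (c / 2) * ?u powr r)"
      by (simp only: exp_add)
    also have "\<dots> \<le> ?H * (E * exp (- ?u))"
      by (intro mult_left_mono E) auto
    finally have 1: "exp (- c * ?u powr r) * exp (- c * ?v powr r) \<le> ?H * (E * exp (- ?u))" .
    \<comment> \<open>Only an inequality, since \<open>sgn ?y\<close> may be
      \<open>0\<close>.\<close>
    have I: "\<bar>Im s\<bar> \<le> \<theta>"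
      using \<theta> unfolding s abs_mult by (auto simp: abs_sgn_eq intro: mult_left_le_one_le)
    have X: "exp (B * (1 + \<bar>Im s\<bar>) powr \<nu>) \<le> ?X"
      using I B \<nu> by (auto intro!: mult_left_mono powr_mono2)
    have Q: "exp (2 * b * \<bar>Im s\<bar> powr (r / (r - 1))) \<le> ?Q"
      using I b r by (auto intro!: mult_left_mono powr_mono2)
    have Y: "exp (- 2 * pi * ?y * Im s) = ?Y" by (simp only: mult.assoc y)
    have "norm (pairing_integrand m a t g z w j \<xi> s) \<le> A * exp (B * (1 + \<bar>Im s\<bar>) powr \<nu>) * ?Y * C\<^sup>2 *
        exp (2 * b * \<bar>Im s\<bar> powr (r / (r - 1))) * (exp (- c * ?u powr r) * exp (- c * ?v powr r))"
      using norm_pairing_integrand_le[of z w j \<xi> s] unfolding Y s(1) axis_zero add_0_right .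
    also have "\<dots> \<le> A * ?X * ?Y * C\<^sup>2 * ?Q * (?H * (E * exp (- ?u)))"
      using A by (intro mult_mono X Q 1) auto
    finally show ?thesis by (simp only: mult.assoc)
  qed
  have int: "integrable lborel (\<lambda>\<xi>. exp (- norm (\<xi> - snd z)))" "(LINT \<xi>|lborel. exp (- norm (\<xi> - snd z))) = (LINT x|lborel. exp (- norm (x :: real^'d)))"
    using integrable_lborel_shift[OF integrable_exp_neg_norm, of "- snd z"]
      lborel_integral_shift[of "\<lambda>x::real^'d. exp (- norm x)" "- snd z"] by simp_all
  have "norm (L2_inner (propagator m a t (tf_shift z g)) (tf_shift w g)) = norm (LINT \<xi>|lborel. pairing_integrand m a t g z w j \<xi> s)"
    unfolding norm_L2_inner_propagator[of z w j] integral_pairing_integrand_shift[of z w j s] ..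
  also have "\<dots> \<le> (LINT \<xi>|lborel. A * ?X * ?Y * C\<^sup>2 * ?Q * (?H * E) * exp (- norm (\<xi> - snd z)))"
    by (rule norm_integral_le_dominated[OF integrable_mult_right[OF int(1)] le])
  also have "\<dots> = A * ?X * ?Y * C\<^sup>2 * ?Q * (?H * E) * (LINT x|lborel. exp (- norm (x :: real^'d)))"
    unfolding integral_mult_right_zero int(2) ..
  also have "\<dots> = A * C\<^sup>2 * E * (LINT x|lborel. exp (- norm (x :: real^'d))) * (?X * ?Q * ?Y * ?H)"
    by (simp only: mult_ac)
  also have "?X * ?Q * ?Y * ?H = exp (B * (1 + \<theta>) powr \<nu> + 2 * b * \<theta> powr (r / (r - 1)) - 2 * pi * \<bar>?y\<bar> * \<theta>
      - c / 2 * (norm (snd w - snd z) / 2) powr r)"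
    by (simp flip: exp_add)
  finally show ?thesis .
qed

end

section \<open>Choice of the exponents and the shift, and the conclusion\<close>

lemma decay_exponent_bounds:
  assumes "\<nu> \<ge> 1"
  shows "decay_exponent \<nu> > 1" "\<nu> \<le> decay_exponent \<nu> / (decay_exponent \<nu> - 1)"
proof -
  show gt: "decay_exponent \<nu> > 1" using assms by (auto simp: decay_exponent_def)
  show "\<nu> \<le> decay_exponent \<nu> / (decay_exponent \<nu> - 1)"
  proof (cases "\<nu> = 1")
    case False
    \<comment> \<open>Conjugation of exponents reverses order:
      \<open>r \<le> \<nu> / (\<nu> - 1)\<close> is equivalent to
      \<open>\<nu> \<le> r / (r - 1)\<close>. Thus growth of order \<open>\<nu>\<close> in the
      imaginary part is no worse than that of the transform of \<open>g\<close>.\<close>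
    hence "decay_exponent \<nu> \<le> \<nu> / (\<nu> - 1)" by (simp add: decay_exponent_def)
    thus ?thesis using gt assms False by (simp add: field_simps)
  qed (simp add: decay_exponent_def)
qed

text \<open>The witness is \<open>\<theta> = d y powr (r - 1)\<close>: all positive terms are \<open>O(1 + d powr q * y powr r)\<close> with
  \<open>q = r / (r - 1) > 1\<close>, hence beaten by the gain \<open>2 \<pi> d * y powr r\<close> for small \<open>d\<close>.\<close>

lemma optimal_shift:
  fixes B b \<nu> r :: real
  assumes r: "r > 1" and \<nu>: "1 \<le> \<nu>" "\<nu> \<le> r / (r - 1)" and B: "B \<ge> 0" and b: "b > 0"
  obtains \<delta> K where "\<delta> > 0" "K > 0" "\<And>y. y \<ge> 0 \<Longrightarrow> \<exists>\<theta>\<ge>0.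
    B * (1 + \<theta>) powr \<nu> + 2 * b * \<theta> powr (r / (r - 1)) - 2 * pi * y * \<theta> \<le> K - \<delta> * y powr r"
proof -
  define q where "q = r / (r - 1)"
  have q: "q > 1" "(r - 1) * q = r" "q - 1 = 1 / (r - 1)" using r by (auto simp: q_def field_simps)
  \<comment> \<open>Both positive terms are at most \<open>K * (1 + \<theta> powr q)\<close>,
    because \<open>(1 + \<theta>) powr \<nu> \<le> 2 powr q * (1 + \<theta> powr q)\<close>.\<close>
  define K where "K = B * 2 powr q + 2 * b"
  have K: "K > 0" using B b by (simp add: K_def add_nonneg_pos)
  \<comment> \<open>Chosen so that \<open>K * d powr q = pi * d\<close>: the loss
    \<open>K * \<theta> powr q\<close> is then exactly half of the gain
    \<open>2 * pi * d * y powr r\<close>.\<close>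
  define d where "d = (pi / K) powr (r - 1)"
  have d: "d > 0" using K by (simp add: d_def)
  have dq: "K * d powr q = pi * d"
  proof -
    have "d powr q = d * d powr (q - 1)" using d by (simp add: powr_diff)
    also have "d powr (q - 1) = pi / K" using K r by (simp add: d_def powr_powr q(3))
    finally show ?thesis using K by simp
  qed
  show thesis
  proof (rule that[of "pi * d" K])
    fix y :: real assume y: "y \<ge> 0"
    define \<theta> where "\<theta> = d * y powr (r - 1)"
    have \<theta>: "\<theta> \<ge> 0" using d by (simp add: \<theta>_def)
    have \<theta>q: "\<theta> powr q = d powr q * y powr r"
      using d q by (simp add: \<theta>_def powr_mult powr_powr)
    have y\<theta>: "y * \<theta> = d * y powr r"
      using y r by (cases "y = 0") (auto simp: \<theta>_def powr_mult_base)
    have "(1 + \<theta>) powr \<nu> \<le> (1 + \<theta>) powr q" using \<nu> \<theta> by (intro powr_mono) (auto simp: q_def)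
    also have "\<dots> \<le> (2 * max 1 \<theta>) powr q" using \<theta> q by (intro powr_mono2) auto
    also have "\<dots> = 2 powr q * (max 1 \<theta>) powr q" using \<theta> by (simp add: powr_mult)
    also have "\<dots> \<le> 2 powr q * (1 + \<theta> powr q)" by (intro mult_left_mono) (auto simp: max_def)
    finally have "B * (1 + \<theta>) powr \<nu> \<le> B * (2 powr q * (1 + \<theta> powr q))" using B by (intro mult_left_mono)
    hence "B * (1 + \<theta>) powr \<nu> + 2 * b * \<theta> powr q \<le> K * (1 + \<theta> powr q)"
      using b by (simp add: K_def algebra_simps)
    also have "\<dots> = K + pi * d * y powr r"
      unfolding \<theta>q by (simp add: distrib_left dq flip: mult.assoc)
    finally have "B * (1 + \<theta>) powr \<nu> + 2 * b * \<theta> powr q - 2 * pi * (y * \<theta>) \<le> K + pi * d * y powr r - 2 * pi * (d * y powr r)"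
      unfolding y\<theta> by simp
    hence "B * (1 + \<theta>) powr \<nu> + 2 * b * \<theta> powr q - 2 * pi * y * \<theta> \<le> K - pi * d * y powr r"
      by (simp add: algebra_simps)
    thus "\<exists>\<theta>\<ge>0. B * (1 + \<theta>) powr \<nu> + 2 * b * \<theta> powr (r / (r - 1)) - 2 * pi * y * \<theta> \<le> K - pi * d * y powr r"
      using \<theta> unfolding q_def by blast
  qed (use d K in auto)
qed

text \<open>Serves to combine decay in position and decay in frequency into decay in the phase-space
  distance.\<close>

lemma norm_prod_powr_le:
  fixes p :: "'a::real_normed_vector \<times> 'b::real_normed_vector"
  assumes "r > 0"
  shows "norm p powr r \<le> 2 powr r * (norm (fst p) powr r + norm (snd p) powr r)"
proof -
  have "norm p \<le> norm (fst p) + norm (snd p)" by (cases p) (simp add: norm_Pair_le)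
  also have "\<dots> \<le> 2 * max (norm (fst p)) (norm (snd p))" by simp
  finally have "norm p powr r \<le> (2 * max (norm (fst p)) (norm (snd p))) powr r"
    using assms by (intro powr_mono2) auto
  also have "\<dots> = 2 powr r * (max (norm (fst p)) (norm (snd p))) powr r" by (simp add: powr_mult)
  also have "\<dots> \<le> 2 powr r * (norm (fst p) powr r + norm (snd p) powr r)"
    by (intro mult_left_mono) (auto simp: max_def)
  finally show ?thesis .
qed

theorem theorem5p3:
  fixes m :: nat
    and a :: "nat \<Rightarrow> ('d::finite) mpoly"
    and C0 \<nu> r :: real
    and g :: "real^'d \<Rightarrow> complex"
  assumes "m \<ge> 1"
    and "C0 > 0" and "\<nu> \<ge> 1"
    and "\<And>(\<tau>::complex) (\<zeta>::complex^'d). full_symbol m a (\<i> * \<tau>) \<zeta> = 0 \<Longrightarrow>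
           Im \<tau> \<ge> - C0 * (1 + norm (Im_vec \<zeta>)) powr \<nu>"
    and "r = decay_exponent \<nu>"
    and "g \<in> gelfand_shilov (1 / r)"
  shows "\<forall>T::real set. T \<subseteq> {0..} \<and> bounded T \<longrightarrow>
           (\<exists>\<epsilon>>0. \<exists>C>0. \<forall>t\<in>T. \<forall>z w.
              norm (L2_inner (propagator m a t (tf_shift z g)) (tf_shift w g))
                \<le> C * exp (- \<epsilon> * norm (w - z) powr r))"
proof (intro allI impI, elim conjE)
  fix T :: "real set" assume T0: "T \<subseteq> {0..}" and "bounded T"
  then obtain T1 where T1: "T1 > 0" "\<And>t. t \<in> T \<Longrightarrow> \<bar>t\<bar> \<le> T1"
    unfolding bounded_pos by auto
  have T: "t \<in> {0..T1}" if "t \<in> T" for t using that T0 T1(2)[OF that] by auto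
  note m = assms(1) and g = assms(6)
  have r: "r > 1" and \<nu>: "1 \<le> \<nu>" "\<nu> \<le> r / (r - 1)"
    using decay_exponent_bounds[OF assms(3)] assms(3,5) by simp_all
  \<comment> \<open>Evaluated at the upper end \<open>T1\<close> of the times, so that both
    constants serve every \<open>t\<close> in \<open>T\<close>.\<close>
  define A where "A = T1 ^ (m - 1)"
  define B where "B = C0 * T1"
  have A: "A > 0" and B: "B \<ge> 0" using T1(1) assms(2) by (simp_all add: A_def B_def)
  have symbol: "norm (ext_symbol m a t \<zeta>) \<le> A * exp (B * (1 + norm (Im_vec \<zeta>)) powr \<nu>)" if t: "t \<in> T" for t \<zeta>
  proof -
    let ?M = "C0 * (1 + norm (Im_vec \<zeta>)) powr \<nu>"
    \<comment> \<open>The substitution \<open>\<tau> = - \<i> * s\<close> gives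
      \<open>\<i> * \<tau> = s\<close> and \<open>Im \<tau> = - Re s\<close>, so the lower bound on
      \<open>Im \<tau>\<close> is an upper bound on \<open>Re s\<close>.\<close>
    have "Re s \<le> ?M" if "full_symbol m a s \<zeta> = 0" for s
      using assms(4)[of "- \<i> * s" \<zeta>] that by (simp add: mult.assoc[symmetric])
    from ext_symbol_bound[OF m this T[OF t]]
    have "norm (ext_symbol m a t \<zeta>) \<le> A * exp (?M * t)" by (simp add: A_def)
    also have "?M * t \<le> ?M * T1"
      using T[OF t] assms(2) by (intro mult_left_mono) auto
    hence "A * exp (?M * t) \<le> A * exp (B * (1 + norm (Im_vec \<zeta>)) powr \<nu>)"
      using A by (simp add: B_def mult_ac)
    finally show ?thesis .
  qed
  obtain c b C where pos: "c > 0" "b > 0" "C > 0" and FL: "\<And>\<zeta>. norm (fourier_laplace g \<zeta>) \<le>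
       C * exp (b * norm (Im_vec \<zeta>) powr (r / (r - 1))) * exp (- c * norm (Re_vec \<zeta>) powr r)"
    by (rule fourier_laplace_gelfand_shilov[OF r g], (rule that; blast))
  \<comment> \<open>Half of the rate \<open>c\<close> is reserved for the convergence of the
    integral over \<open>\<xi>\<close>.\<close>
  have c2: "c / 2 > 0" using pos by simp
  obtain b' E where "b' > 0" and E0: "E > 0" and E: "\<And>x y. x \<ge> 0 \<Longrightarrow> y \<ge> 0 \<Longrightarrow>
       exp (- (c / 2) * x powr r + 2 * pi * x * y) \<le> E * exp (b' * y powr (r / (r - 1))) * exp (- x)"
    by (rule exp_young[OF r c2], (rule that; blast))
  have E': "exp (- (c / 2) * x powr r) \<le> E * exp (- x)" if "x \<ge> 0" for x
    using E[OF that order_refl] by simp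
  obtain \<delta> K where \<delta>: "\<delta> > 0" "K > 0" and shift: "\<And>y. y \<ge> 0 \<Longrightarrow> \<exists>\<theta>\<ge>0.
    B * (1 + \<theta>) powr \<nu> + 2 * b * \<theta> powr (r / (r - 1)) - 2 * pi * y * \<theta> \<le> K - \<delta> * y powr r"
    by (rule optimal_shift[OF r \<nu> B pos(2)], (rule that; blast))
  define I where "I = (LINT x|lborel. exp (- norm (x :: real^'d)))"
  have I: "I \<ge> 0" unfolding I_def by (rule Bochner_Integration.integral_nonneg) auto
  define d where "d = real CARD('d)"
  have d: "d > 0" by (simp add: d_def)
  \<comment> \<open>The smaller of two rates: in position, \<open>\<delta>\<close> reduced by the
    passage to a single coordinate; in frequency, the remaining half of \<open>c\<close> reduced by
    halving the distance.\<close>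
  define e where "e = min (\<delta> * (1 / d) powr r) (c / 2 * (1 / 2) powr r)"
  have e: "e > 0" using \<delta> pos d by (simp add: e_def)
  have "norm (L2_inner (propagator m a t (tf_shift z g)) (tf_shift w g)) \<le>
      (A * C\<^sup>2 * E * I * exp K + 1) * exp (- (e / 2 powr r) * norm (w - z) powr r)" if t: "t \<in> T" for t z w
  proof -
    \<comment> \<open>The coordinate in which the frequency is shifted: the largest one of the
      difference in position.\<close>
    obtain j where j: "norm (fst w - fst z) \<le> d * \<bar>(fst w - fst z) $ j\<bar>"
      unfolding d_def by (rule exists_large_component)
    let ?y = "\<bar>(fst w - fst z) $ j\<bar>"
    obtain \<theta> where \<theta>: "\<theta> \<ge> 0" "B * (1 + \<theta>) powr \<nu> + 2 * b * \<theta> powr (r / (r - 1)) - 2 * pi * ?y * \<theta> \<le> K - \<delta> * ?y powr r"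
      using shift[of ?y] by auto
    have t0: "t \<ge> 0" using T[OF t] by simp
    have A0: "A \<ge> 0" using A by simp
    have "norm (L2_inner (propagator m a t (tf_shift z g)) (tf_shift w g)) \<le> A * C\<^sup>2 * E * I *
        exp (B * (1 + \<theta>) powr \<nu> + 2 * b * \<theta> powr (r / (r - 1)) - 2 * pi * ?y * \<theta> - c / 2 * (norm (snd w - snd z) / 2) powr r)"
      unfolding I_def
      by (rule norm_L2_inner_propagator_le[OF m t0 r g A0 B \<nu>(1) symbol[OF t] pos(2,1,3) FL \<theta>(1) E'])
    also have "\<dots> \<le> A * C\<^sup>2 * E * I * exp (K - (e / 2 powr r) * norm (w - z) powr r)"
    proof -
      have "(norm (fst w - fst z) / d) powr r \<le> ?y powr r"
        using j d r by (intro powr_mono2) (auto simp: field_simps)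
      hence "\<delta> * ((1 / d) powr r * norm (fst w - fst z) powr r) \<le> \<delta> * ?y powr r"
        using \<delta> d by (intro mult_left_mono) (auto simp: powr_divide)
      moreover have "e * norm (fst w - fst z) powr r \<le> \<delta> * (1 / d) powr r * norm (fst w - fst z) powr r"
        by (intro mult_right_mono) (auto simp: e_def)
      ultimately have 1: "e * norm (fst w - fst z) powr r \<le> \<delta> * ?y powr r" by (simp only: mult.assoc)
      have "e * norm (snd w - snd z) powr r \<le> c / 2 * (1 / 2) powr r * norm (snd w - snd z) powr r"
        by (intro mult_right_mono) (auto simp: e_def)
      also have "\<dots> = c / 2 * (norm (snd w - snd z) / 2) powr r"
        by (simp add: powr_divide)
      finally have 2: "e * norm (snd w - snd z) powr r \<le> c / 2 * (norm (snd w - snd z) / 2) powr r" .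
      have "e / 2 powr r * norm (w - z) powr r \<le> e / 2 powr r * (2 powr r * (norm (fst w - fst z) powr r + norm (snd w - snd z) powr r))"
        using norm_prod_powr_le[of r "w - z"] r e by (intro mult_left_mono) auto
      also have "\<dots> = e * norm (fst w - fst z) powr r + e * norm (snd w - snd z) powr r"
        by (simp add: distrib_left)
      finally show ?thesis
        using 1 2 \<theta>(2) A E0 I by (intro mult_left_mono) auto
    qed
    also have "\<dots> = A * C\<^sup>2 * E * I * exp K * exp (- (e / 2 powr r) * norm (w - z) powr r)"
      by (simp add: mult.assoc flip: exp_add)
    \<comment> \<open>The integral \<open>I\<close> is only known to be nonnegative; the added
      \<open>1\<close> keeps the final constant positive.\<close>
    also have "\<dots> \<le> (A * C\<^sup>2 * E * I * exp K + 1) * exp (- (e / 2 powr r) * norm (w - z) powr r)"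
      by (intro mult_right_mono) auto
    finally show ?thesis .
  qed
  moreover have "e / 2 powr r > 0" using e by simp
  moreover have "A * C\<^sup>2 * E * I * exp K + 1 > 0"
    using A E0 I by (intro add_nonneg_pos mult_nonneg_nonneg) auto
  ultimately show "\<exists>\<epsilon>>0. \<exists>C>0. \<forall>t\<in>T. \<forall>z w.
      norm (L2_inner (propagator m a t (tf_shift z g)) (tf_shift w g)) \<le> C * exp (- \<epsilon> * norm (w - z) powr r)"
    by blast
qed

end
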